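(* Let $\mathfrak{s}=\mathfrak{so}(3)$ and let $\mathfrak{r}$ be a four-dimensional solvable real Lie algebra with trivial center, $\mathfrak{z}(\mathfrak{r})=\{0\}$. Then the Lie algebra $\mathfrak{g}=\mathfrak{so}(3)\oplus\mathfrak{r}$ (product of Lie algebras) does not admit any closed $\mathrm{G}_2$-structure.
   Context: All Lie algebras are real and finite-dimensional; $d$ denotes the Chevalley-Eilenberg differential of $\mathfrak{g}$ (on $1$-forms $d\alpha(x,y)=-\alpha([x,y])$, extended to $\Lambda^*(\mathfrak{g}^* )$ as a graded derivation). $\mathrm{G}_2$-structures. Let $\dim\mathfrak{g}=7$. For $\phi\in\Lambda^3(\mathfrak{g}^* )$ let $b_\phi:\mathfrak{g}\times\mathfrak{g}\to\Lambda^7(\mathfrak{g}^* )$ be the symmetric bilinear map $b_\phi(v,w)=\frac16\,\iota_v\phi\wedge\iota_w\phi\wedge\phi$. Its determinant has a well-defined ninth root $\det(b_\phi)^{1/9}\in\Lambda^7(\mathfrak{g}^* )$: if in a basis one writes $b_\phi(e_i,e_j)=B_{ij}\,e^1\wedge\cdots\wedge e^7$, then $\det(b_\phi)^{1/9}=\det(B)^{1/9}e^1\wedge\cdots\wedge e^7$ (real ninth root). The form $\phi$ is stable if $\det(b_\phi)^{1/9}\neq0$ (equivalently, its $\mathrm{GL}(\mathfrak{g})$-orbit is open in $\Lambda^3(\mathfrak{g}^* )$). A $\mathrm{G}_2$-structure on $\mathfrak{g}$ is a stable $3$-form $\varphi$ such that the bilinear form $g_\varphi=\det(b_\varphi)^{-1/9}b_\varphi:\mathfrak{g}\times\mathfrak{g}\to\mathbb{R}$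 is positive definite. It is closed if $d\varphi=0$. *)

theory Defs
  imports "HOL-Analysis.Analysis"
begin

section \<open>Lie algebras\<close>

locale lie_algebra =
  fixes br :: "'a::real_vector \<Rightarrow> 'a \<Rightarrow> 'a"
  assumes bilinear_br: "bilinear br"
    and br_self: "br x x = 0"
    and jacobi: "br x (br y z) + br y (br z x) + br z (br x y) = 0"

definition lie_center :: "('a::real_vector \<Rightarrow> 'a \<Rightarrow> 'a) \<Rightarrow> 'a set" where
  "lie_center br = {z. \<forall>x. br z x = 0}"

primrec derived_series :: "('a::real_vector \<Rightarrow> 'a \<Rightarrow> 'a) \<Rightarrow> nat \<Rightarrow> 'a set" where
  "derived_series br 0 = UNIV"
| "derived_series br (Suc n) =
     span {br x y | x y. x \<in> derived_series br n \<and> y \<in> derived_series br n}"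

definition lie_solvable :: "('a::real_vector \<Rightarrow> 'a \<Rightarrow> 'a) \<Rightarrow> bool" where
  "lie_solvable br \<longleftrightarrow> (\<exists>n. derived_series br n = {0})"

definition lie_prod ::
  "('a::real_vector \<Rightarrow> 'a \<Rightarrow> 'a) \<Rightarrow> ('b::real_vector \<Rightarrow> 'b \<Rightarrow> 'b) \<Rightarrow> 'a \<times> 'b \<Rightarrow> 'a \<times> 'b \<Rightarrow> 'a \<times> 'b" where
  "lie_prod br1 br2 u v = (br1 (fst u) (fst v), br2 (snd u) (snd v))"

lemma lie_algebra_lie_prod:
  assumes "lie_algebra br1" and "lie_algebra br2"
  shows "lie_algebra (lie_prod br1 br2)"
proof -
  interpret A: lie_algebra br1 by fact
  interpret B: lie_algebra br2 by fact
  show ?thesis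
  proof
    show "bilinear (lie_prod br1 br2)"
      using A.bilinear_br B.bilinear_br
      by (auto simp: bilinear_def lie_prod_def linear_iff)
  qed (auto simp: lie_prod_def A.br_self B.br_self A.jacobi B.jacobi zero_prod_def)
qed


section \<open>The Lie algebra so(3)\<close>

lemma transpose_lin:
  fixes A B :: "real^'n^'m"
  shows "transpose (0 :: real^'n^'m) = 0"
    and "transpose (A + B) = transpose A + transpose B"
    and "transpose (A - B) = transpose A - transpose B"
    and "transpose (- A) = - transpose A"
    and "transpose (c *\<^sub>R A) = c *\<^sub>R transpose A"
  by (simp_all add: vec_eq_iff transpose_def)

typedef so3 = "{A :: real^3^3. transpose A = - A}"
  by (rule exI[of _ 0]) (simp add: transpose_lin)

setup_lifting type_definition_so3

instantiation so3 :: real_vector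
begin

lift_definition zero_so3 :: so3 is 0
  by (simp add: transpose_lin)
lift_definition plus_so3 :: "so3 \<Rightarrow> so3 \<Rightarrow> so3" is "(+)"
  by (simp add: transpose_lin)
lift_definition minus_so3 :: "so3 \<Rightarrow> so3 \<Rightarrow> so3" is "(-)"
  by (simp add: transpose_lin)
lift_definition uminus_so3 :: "so3 \<Rightarrow> so3" is uminus
  by (simp add: transpose_lin)
lift_definition scaleR_so3 :: "real \<Rightarrow> so3 \<Rightarrow> so3" is "(*\<^sub>R)"
  by (simp add: transpose_lin)

instance
  by standard (transfer; simp add: algebra_simps)+

end

lift_definition so3_bracket :: "so3 \<Rightarrow> so3 \<Rightarrow> so3" is "\<lambda>A B. A ** B - B ** A"
proof -
  fix A B :: "real^3^3"
  assume h: "transpose A = - A" "transpose B = - B"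
  have m: "(- X) ** (- Y) = X ** Y" for X Y :: "real^3^3"
    by (simp add: vec_eq_iff matrix_matrix_mult_def)
  show "transpose (A ** B - B ** A) = - (A ** B - B ** A)"
    by (simp add: transpose_lin matrix_transpose_mul h m)
qed

lemma lie_algebra_so3: "lie_algebra so3_bracket"
proof
  have ml: "(X + Y) ** Z = X ** Z + Y ** Z" "(X - Y) ** Z = X ** Z - Y ** Z"
    for X Y Z :: "real^3^3"
    by (simp_all add: vec_eq_iff matrix_matrix_mult_def algebra_simps sum.distrib sum_subtractf)
  have mr: "Z ** (X + Y) = Z ** X + Z ** Y" "Z ** (X - Y) = Z ** X - Z ** Y"
    for X Y Z :: "real^3^3"
    by (simp_all add: vec_eq_iff matrix_matrix_mult_def algebra_simps sum.distrib sum_subtractf)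
  have ms: "(c *\<^sub>R X) ** Z = c *\<^sub>R (X ** Z)" "Z ** (c *\<^sub>R X) = c *\<^sub>R (Z ** X)"
    for X Z :: "real^3^3" and c :: real
    by (simp_all only: scalar_matrix_assoc[symmetric] matrix_scalar_ac)
  have add: "so3_bracket (x + y) z = so3_bracket x z + so3_bracket y z" for x y z
    by transfer (simp add: ml mr)
  have scale: "so3_bracket (c *\<^sub>R x) z = c *\<^sub>R so3_bracket x z" for c x z
    by transfer (simp add: ms scaleR_diff_right)
  have anti: "so3_bracket x y = - so3_bracket y x" for x y
    by transfer simp
  have l: "linear (\<lambda>x. so3_bracket x z)" for z
    by (rule linearI) (rule add scale)+
  have "linear (\<lambda>x. so3_bracket z x)" for z
    using linear_compose_neg[OF l[of z]] by (subst anti)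
  with l show "bilinear so3_bracket"
    by (simp add: bilinear_def)
  show "so3_bracket x x = 0" for x
    by transfer simp
  show "so3_bracket x (so3_bracket y z) + so3_bracket y (so3_bracket z x)
      + so3_bracket z (so3_bracket x y) = 0" for x y z
    by transfer (simp add: ml mr matrix_mul_assoc)
qed


section \<open>Exterior forms\<close>

text \<open>
  An element of the exterior algebra of the dual space is a function on lists of vectors; its
  degree-k component is the restriction to lists of length k.
\<close>

definition multilinear_form :: "('a::real_vector list \<Rightarrow> real) \<Rightarrow> bool" where
  "multilinear_form \<omega> \<longleftrightarrow> (\<forall>xs. \<forall>i < length xs. linear (\<lambda>v. \<omega> (xs[i := v])))"

definition alternating_form :: "('a::real_vector list \<Rightarrow> real) \<Rightarrow> bool" where
  "alternating_form \<omega> \<longleftrightarrow> multilinear_form \<omega> \<and> (\<forall>xs. \<not> distinct xs \<longrightarrow> \<omega> xs = 0)"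

definition forms :: "nat \<Rightarrow> ('a::real_vector list \<Rightarrow> real) set" where
  "forms k = {\<omega>. alternating_form \<omega> \<and> (\<forall>xs. length xs \<noteq> k \<longrightarrow> \<omega> xs = 0)}"

definition contract :: "'a \<Rightarrow> ('a list \<Rightarrow> real) \<Rightarrow> 'a list \<Rightarrow> real" where
  "contract v \<omega> xs = \<omega> (v # xs)"

text \<open>
  The shuffle formula: \<open>I\<close> is the set of positions whose entries are fed to \<open>\<alpha>\<close>, and the exponent
  counts the inversions of the corresponding shuffle.
\<close>

definition wedge :: "('a list \<Rightarrow> real) \<Rightarrow> ('a list \<Rightarrow> real) \<Rightarrow> 'a list \<Rightarrow> real" (infixr "\<and>\<^sub>w" 70) where
  "(\<alpha> \<and>\<^sub>w \<beta>) xs = (\<Sum>I \<in> Pow {..<length xs}.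
     (-1) ^ card {(i, j). i \<in> I \<and> j \<in> {..<length xs} - I \<and> j < i}
       * \<alpha> (nths xs I) * \<beta> (nths xs (- I)))"

definition ce_d :: "('a \<Rightarrow> 'a \<Rightarrow> 'a) \<Rightarrow> ('a list \<Rightarrow> real) \<Rightarrow> 'a list \<Rightarrow> real" where
  "ce_d br \<omega> xs = (\<Sum>j<length xs. \<Sum>i<j.
     (-1) ^ (i + j) * \<omega> (br (xs ! i) (xs ! j) # nths xs (- {i, j})))"

text \<open>The remainder of this section relates \<open>ce_d\<close> to the graded Leibniz rule.\<close>

definition grade_sign :: "('a list \<Rightarrow> real) \<Rightarrow> 'a list \<Rightarrow> real" where
  "grade_sign \<omega> xs = (-1) ^ length xs * \<omega> xs"

lemma wedge_Nil: "(\<alpha> \<and>\<^sub>w \<beta>) [] = \<alpha> [] * \<beta> []"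
  by (simp add: wedge_def)

lemma sum_Pow_Suc:
  fixes f :: "nat set \<Rightarrow> real"
  shows "(\<Sum>I \<in> Pow {..<Suc n}. f I) = (\<Sum>J \<in> Pow {..<n}. f (insert 0 (Suc ` J)) + f (Suc ` J))"
proof -
  have inj: "inj_on ((`) Suc) A" for A
    by (simp add: inj_on_def inj_image_eq_iff)
  have inj': "inj_on (\<lambda>J. insert 0 (Suc ` J)) A" for A
    by (rule inj_onI) (metis (no_types, lifting) Diff_insert_absorb image_iff inj_Suc inj_image_eq_iff nat.distinct(1))
  have "Pow {..<Suc n} = Pow (Suc ` {..<n}) \<union> insert 0 ` Pow (Suc ` {..<n})"
    unfolding lessThan_Suc_eq_insert_0 Pow_insert ..
  also have "\<dots> = (`) Suc ` Pow {..<n} \<union> (\<lambda>J. insert 0 (Suc ` J)) ` Pow {..<n}"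
    by (simp add: image_Pow_surj image_image flip: image_Pow_surj)
  also have "sum f \<dots> = sum f ((`) Suc ` Pow {..<n}) + sum f ((\<lambda>J. insert 0 (Suc ` J)) ` Pow {..<n})"
    by (rule sum.union_disjoint) auto
  finally show ?thesis
    by (simp add: sum.reindex inj inj' sum.distrib)
qed

lemma wedge_Cons:
  "(\<alpha> \<and>\<^sub>w \<beta>) (x # xs) = (contract x \<alpha> \<and>\<^sub>w \<beta>) xs + (grade_sign \<alpha> \<and>\<^sub>w contract x \<beta>) xs"
proof -
  define n where "n = length xs"
  define N where "N n I = {(i, j). i \<in> I \<and> j \<in> {..<n} - I \<and> j < i}" for n and I :: "nat set"
  have fin: "finite (N n J)" if "J \<in> Pow {..<n}" for J n
    by (rule finite_subset[of _ "{..<n} \<times> {..<n}"]) (use that in \<open>auto simp: N_def\<close>)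
  have c: "card (map_prod Suc Suc ` A) = card A" for A
    by (rule card_image) (auto simp: inj_on_def)
  have N1: "card (N (Suc n) (insert 0 (Suc ` J))) = card (N n J)" for J
  proof -
    have "N (Suc n) (insert 0 (Suc ` J)) = map_prod Suc Suc ` N n J"
      by (auto simp: N_def image_iff less_Suc_eq_0_disj)
    then show ?thesis by (simp add: c)
  qed
  have N2: "card (N (Suc n) (Suc ` J)) = card J + card (N n J)" if J: "J \<in> Pow {..<n}" for J
  proof -
    have fJ: "finite J" using J by (auto intro: finite_subset)
    have "N (Suc n) (Suc ` J) = (\<lambda>i. (Suc i, 0)) ` J \<union> map_prod Suc Suc ` N n J"
      by (auto simp: N_def image_iff less_Suc_eq_0_disj)
    moreover have "card \<dots> = card ((\<lambda>i. (Suc i, 0::nat)) ` J) + card (map_prod Suc Suc ` N n J)"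
      by (rule card_Un_disjoint) (use fJ fin[OF J] in auto)
    moreover have "card ((\<lambda>i. (Suc i, 0::nat)) ` J) = card J"
      by (rule card_image) (auto simp: inj_on_def)
    ultimately show ?thesis by (simp add: c)
  qed
  have S: "{j. Suc j \<in> Suc ` J} = J" "{j. Suc j \<notin> Suc ` J} = - J" for J
    by auto
  have l: "length (nths xs J) = card J" if "J \<in> Pow {..<n}" for J
  proof -
    have "{i. i < length xs \<and> i \<in> J} = J" using that by (auto simp: n_def)
    then show ?thesis by (simp add: length_nths)
  qed
  have "(\<alpha> \<and>\<^sub>w \<beta>) (x # xs) = (\<Sum>I \<in> Pow {..<Suc n}.
      (-1) ^ card (N (Suc n) I) * \<alpha> (nths (x # xs) I) * \<beta> (nths (x # xs) (- I)))"
    by (simp add: wedge_def n_def N_def)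
  also have "\<dots> = (\<Sum>J \<in> Pow {..<n}.
      (-1) ^ card (N n J) * contract x \<alpha> (nths xs J) * \<beta> (nths xs (- J))
      + (-1) ^ card (N n J) * grade_sign \<alpha> (nths xs J) * contract x \<beta> (nths xs (- J)))"
    unfolding sum_Pow_Suc
    by (rule sum.cong[OF refl])
      (simp add: N1 N2 nths_Cons S l contract_def grade_sign_def power_add Compl_eq mult_ac)
  finally show ?thesis
    by (simp add: wedge_def n_def N_def sum.distrib)
qed

lemma wedge_linear:
  "((\<lambda>xs. \<alpha> xs + \<alpha>' xs) \<and>\<^sub>w \<beta>) xs = (\<alpha> \<and>\<^sub>w \<beta>) xs + (\<alpha>' \<and>\<^sub>w \<beta>) xs"
  "((\<lambda>xs. \<alpha> xs - \<alpha>' xs) \<and>\<^sub>w \<beta>) xs = (\<alpha> \<and>\<^sub>w \<beta>) xs - (\<alpha>' \<and>\<^sub>w \<beta>) xs"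
  "(\<alpha> \<and>\<^sub>w (\<lambda>xs. \<beta> xs - \<beta>' xs)) xs = (\<alpha> \<and>\<^sub>w \<beta>) xs - (\<alpha> \<and>\<^sub>w \<beta>') xs"
  "((\<lambda>xs. - \<alpha> xs) \<and>\<^sub>w \<beta>) xs = - (\<alpha> \<and>\<^sub>w \<beta>) xs"
  "((\<lambda>xs. c * \<alpha> xs) \<and>\<^sub>w \<beta>) xs = c * (\<alpha> \<and>\<^sub>w \<beta>) xs"
  "(\<alpha> \<and>\<^sub>w (\<lambda>xs. \<beta> xs + \<beta>' xs)) xs = (\<alpha> \<and>\<^sub>w \<beta>) xs + (\<alpha> \<and>\<^sub>w \<beta>') xs"
  "(\<alpha> \<and>\<^sub>w (\<lambda>xs. - \<beta> xs)) xs = - (\<alpha> \<and>\<^sub>w \<beta>) xs"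
  "(\<alpha> \<and>\<^sub>w (\<lambda>xs. c * \<beta> xs)) xs = c * (\<alpha> \<and>\<^sub>w \<beta>) xs"
  by (simp_all add: wedge_def algebra_simps sum.distrib sum_negf sum_subtractf sum_distrib_left)

definition skew_form :: "('a list \<Rightarrow> real) \<Rightarrow> bool" where
  "skew_form \<omega> \<longleftrightarrow> (\<forall>us a b vs. \<omega> (us @ a # b # vs) = - \<omega> (us @ b # a # vs))"

lemma skew_form_alternating:
  assumes "alternating_form \<omega>"
  shows "skew_form \<omega>"
  unfolding skew_form_def
proof (intro allI)
  fix us vs and a b :: 'a
  have lin: "linear (\<lambda>v. \<omega> (xs[i := v]))" if "i < length xs" for xs i
    using assms that by (auto simp: alternating_form_def multilinear_form_def)
  have z: "\<omega> (us @ v # v # vs) = 0" for v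
    using assms by (simp add: alternating_form_def)
  have 1: "\<omega> (us @ (v + v') # w # vs) = \<omega> (us @ v # w # vs) + \<omega> (us @ v' # w # vs)" for v v' w
    using linear_add[OF lin[of "length us" "us @ v # w # vs"], of v v'] by simp
  have 2: "\<omega> (us @ w # (v + v') # vs) = \<omega> (us @ w # v # vs) + \<omega> (us @ w # v' # vs)" for v v' w
    using linear_add[OF lin[of "Suc (length us)" "us @ w # v # vs"], of v v'] 
    by (simp add: list_update_append)
  show "\<omega> (us @ a # b # vs) = - \<omega> (us @ b # a # vs)"
    using z[of "a + b"] z[of a] z[of b] unfolding 1 2 by linarith
qed

lemma skew_contract: "skew_form \<omega> \<Longrightarrow> skew_form (contract x \<omega>)"
  unfolding skew_form_def contract_def by (metis append_Cons)

lemma skew_grade_sign: "skew_form \<omega> \<Longrightarrow> skew_form (grade_sign \<omega>)"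
  unfolding skew_form_def grade_sign_def by (metis (no_types, lifting) length_append length_Cons mult_minus_right)

lemma contract_grade_sign: "contract x (grade_sign \<omega>) = (\<lambda>xs. - grade_sign (contract x \<omega>) xs)"
  by (simp add: contract_def grade_sign_def fun_eq_iff)

lemma contract_wedge:
  "contract x (\<alpha> \<and>\<^sub>w \<beta>) = (\<lambda>xs. (contract x \<alpha> \<and>\<^sub>w \<beta>) xs + (grade_sign \<alpha> \<and>\<^sub>w contract x \<beta>) xs)"
  by (rule ext) (subst contract_def, rule wedge_Cons)

lemma skew_contract_contract:
  "skew_form \<omega> \<Longrightarrow> contract b (contract a \<omega>) = (\<lambda>xs. - contract a (contract b \<omega>) xs)"
  unfolding skew_form_def contract_def fun_eq_iff by (metis append_Nil)

lemma skew_wedge: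
  assumes "skew_form \<alpha>" "skew_form \<beta>"
  shows "skew_form (\<alpha> \<and>\<^sub>w \<beta>)"
proof -
  have "(\<alpha> \<and>\<^sub>w \<beta>) (us @ a # b # vs) = - (\<alpha> \<and>\<^sub>w \<beta>) (us @ b # a # vs)" for us a b vs
    using assms
  proof (induction us arbitrary: \<alpha> \<beta>)
    case Nil
    have g: "grade_sign (grade_sign \<alpha>) = \<alpha>"
      by (simp add: grade_sign_def fun_eq_iff flip: power_add mult.assoc)
    show ?case
      by (simp add: wedge_Cons contract_grade_sign wedge_linear g
          skew_contract_contract[OF Nil(1), of b a] skew_contract_contract[OF Nil(2), of b a])
  next
    case (Cons y us)
    show ?case
      by (simp add: wedge_Cons Cons skew_contract skew_grade_sign)
  qed
  then show ?thesis unfolding skew_form_def by blast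
qed

definition lie_deriv :: "('a \<Rightarrow> 'a \<Rightarrow> 'a) \<Rightarrow> 'a \<Rightarrow> ('a list \<Rightarrow> real) \<Rightarrow> 'a list \<Rightarrow> real" where
  "lie_deriv br x \<omega> xs = - (\<Sum>j<length xs. \<omega> (xs[j := br x (xs ! j)]))"

lemma lie_deriv_Nil: "lie_deriv br x \<omega> [] = 0"
  by (simp add: lie_deriv_def)

lemma lie_deriv_Cons:
  "lie_deriv br x \<omega> (y # ys) = lie_deriv br x (contract y \<omega>) ys - contract (br x y) \<omega> ys"
  by (simp add: lie_deriv_def contract_def sum.lessThan_Suc_shift del: sum.lessThan_Suc)

lemma lie_deriv_lin:
  "lie_deriv br x (\<lambda>xs. \<alpha> xs + \<beta> xs) xs = lie_deriv br x \<alpha> xs + lie_deriv br x \<beta> xs"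
  "lie_deriv br x (grade_sign \<alpha>) = grade_sign (lie_deriv br x \<alpha>)"
  by (auto simp: lie_deriv_def grade_sign_def sum.distrib sum_distrib_left fun_eq_iff)

lemma lie_deriv_wedge:
  "lie_deriv br x (\<alpha> \<and>\<^sub>w \<beta>) xs = (lie_deriv br x \<alpha> \<and>\<^sub>w \<beta>) xs + (\<alpha> \<and>\<^sub>w lie_deriv br x \<beta>) xs"
proof (induction xs arbitrary: \<alpha> \<beta>)
  case Nil
  show ?case by (simp add: lie_deriv_Nil wedge_Nil)
next
  case (Cons y ys)
  have c: "contract y (lie_deriv br x \<omega>)
      = (\<lambda>xs. lie_deriv br x (contract y \<omega>) xs + - contract (br x y) \<omega> xs)" for \<omega>
    by (simp add: contract_def[of y "lie_deriv br x \<omega>"] lie_deriv_Cons fun_eq_iff)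
  show ?case
    by (simp add: lie_deriv_Cons contract_wedge lie_deriv_lin Cons wedge_Cons c wedge_linear)
qed

lemma skew_move:
  assumes "skew_form \<omega>"
  shows "\<omega> (y # us @ vs) = (-1) ^ length us * \<omega> (us @ y # vs)"
  using assms
proof (induction us arbitrary: \<omega>)
  case (Cons u us)
  have "\<omega> (y # u # us @ vs) = - \<omega> (u # y # us @ vs)"
    using Cons.prems unfolding skew_form_def by (metis append_Nil)
  then show ?case
    using Cons.IH[OF skew_contract[OF Cons.prems, of u]] by (simp add: contract_def)
qed simp

lemma nths_remove: "j < length xs \<Longrightarrow> nths xs (- {j}) = take j xs @ drop (Suc j) xs"
proof (induction xs arbitrary: j)
  case (Cons x xs)
  show ?case
  proof (cases j)
    case 0
    then show ?thesis by (simp add: nths_Cons nths_all)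
  next
    case (Suc k)
    then have "{i. Suc i \<in> - {j}} = - {k}" by auto
    then show ?thesis using Cons Suc by (simp add: nths_Cons)
  qed
qed simp

lemma ce_d_Nil: "ce_d br \<omega> [] = 0"
  by (simp add: ce_d_def)

lemma ce_d_Cons:
  assumes "skew_form \<omega>"
  shows "ce_d br \<omega> (x # xs) = lie_deriv br x \<omega> xs - ce_d br (contract x \<omega>) xs"
proof -
  have a: "(-1) ^ Suc j * \<omega> (br x (xs ! j) # nths xs (- {j})) = - \<omega> (xs[j := br x (xs ! j)])"
    if "j < length xs" for j
    using that skew_move[OF assms, of "br x (xs ! j)" "take j xs" "drop (Suc j) xs"]
    by (simp add: nths_remove upd_conv_take_nth_drop min_def flip: power_add mult.assoc)
  have s: "{k. k \<noteq> j} = - {j}" "{k. k \<noteq> i \<and> k \<noteq> j} = - {i, j}" for i j :: nat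
    by auto
  have b: "\<omega> (br y z # x # zs) = - contract x \<omega> (br y z # zs)" for y z zs
    using assms unfolding skew_form_def contract_def by (metis append_Nil)
  have "ce_d br \<omega> (x # xs)
      = (\<Sum>j<length xs. (-1) ^ Suc j * \<omega> (br x (xs ! j) # nths xs (- {j}))
        + (\<Sum>i<j. - ((-1) ^ (i + j) * contract x \<omega> (br (xs ! i) (xs ! j) # nths xs (- {i, j})))))"
    unfolding ce_d_def
    by (simp add: sum.lessThan_Suc_shift nths_Cons s b del: sum.lessThan_Suc)
  also have "\<dots> = lie_deriv br x \<omega> xs - ce_d br (contract x \<omega>) xs"
    unfolding lie_deriv_def ce_d_def
    by (simp add: sum.distrib sum_negf sum_subtractf a del: power_Suc)
  finally show ?thesis .
qed

lemma ce_d_add: "ce_d br (\<lambda>xs. \<alpha> xs + \<beta> xs) xs = ce_d br \<alpha> xs + ce_d br \<beta> xs"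
  by (simp add: ce_d_def sum.distrib algebra_simps)

lemma ce_d_scale: "ce_d br (\<lambda>xs. c * \<alpha> xs) xs = c * ce_d br \<alpha> xs"
  by (simp add: ce_d_def sum_distrib_left mult_ac)

lemma ce_d_grade_sign:
  fixes \<alpha> :: "'a list \<Rightarrow> real"
  shows "ce_d br (grade_sign \<alpha>) = (\<lambda>xs. - grade_sign (ce_d br \<alpha>) xs)"
proof
  fix xs :: "'a list"
  have l: "(-1::real) ^ Suc (length (nths xs (- {i, j}))) = - ((-1) ^ length xs)"
    if "i < j" "j < length xs" for i j
  proof -
    have "{k. k < length xs \<and> k \<in> - {i, j}} = {..<length xs} - {i, j}" by auto
    then have len: "length (nths xs (- {i, j})) = length xs - 2"
      using that by (simp add: length_nths card_Diff_subset)
    have "length xs = Suc (Suc (length xs - 2))" using that by simp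
    then obtain m where "length xs = Suc (Suc m)" ..
    with len show ?thesis by simp
  qed
  show "ce_d br (grade_sign \<alpha>) xs = - grade_sign (ce_d br \<alpha>) xs"
    unfolding ce_d_def grade_sign_def sum_distrib_left sum_negf[symmetric]
    by (intro sum.cong refl) (simp add: l del: power_Suc)
qed

text \<open>
  \<open>ce_d br\<close> is the graded derivation extending the differential on 1-forms: besides being linear
  (\<open>ce_d_add\<close>, \<open>ce_d_scale\<close>), it satisfies \<open>ce_d_one_form\<close> and \<open>ce_d_wedge\<close>.
\<close>

lemma ce_d_one_form: "ce_d br \<alpha> [x, y] = - \<alpha> [br x y]"
  by (simp add: ce_d_def nths_Cons lessThan_Suc numeral_2_eq_2)

lemma ce_d_wedge_skew:
  assumes "skew_form \<alpha>" "skew_form \<beta>"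
  shows "ce_d br (\<alpha> \<and>\<^sub>w \<beta>) xs = (ce_d br \<alpha> \<and>\<^sub>w \<beta>) xs + (grade_sign \<alpha> \<and>\<^sub>w ce_d br \<beta>) xs"
  using assms
proof (induction xs arbitrary: \<alpha> \<beta>)
  case Nil
  show ?case by (simp add: ce_d_Nil wedge_Nil)
next
  case (Cons x xs)
  note sk = Cons.prems skew_contract[OF Cons.prems(1)] skew_contract[OF Cons.prems(2)]
    skew_grade_sign[OF Cons.prems(1)]
  have g: "grade_sign (grade_sign \<alpha>) = \<alpha>"
    by (simp add: grade_sign_def fun_eq_iff flip: power_add mult.assoc)
  have c: "contract x (ce_d br \<omega>) = (\<lambda>xs. lie_deriv br x \<omega> xs + - ce_d br (contract x \<omega>) xs)"
    if "skew_form \<omega>" for \<omega>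
    by (simp add: contract_def[of x "ce_d br \<omega>"] ce_d_Cons that fun_eq_iff)
  show ?case
    by (simp add: ce_d_Cons skew_wedge sk contract_wedge ce_d_add Cons.IH lie_deriv_wedge
        wedge_Cons c wedge_linear ce_d_grade_sign contract_grade_sign g)
qed

lemma ce_d_wedge:
  assumes "\<alpha> \<in> forms k" "\<beta> \<in> forms l"
  shows "ce_d br (\<alpha> \<and>\<^sub>w \<beta>) xs = (ce_d br \<alpha> \<and>\<^sub>w \<beta>) xs + (-1) ^ k * (\<alpha> \<and>\<^sub>w ce_d br \<beta>) xs"
proof -
  have "grade_sign \<alpha> = (\<lambda>xs. (-1) ^ k * \<alpha> xs)"
    using assms(1) by (auto simp: forms_def grade_sign_def fun_eq_iff)
  with assms show ?thesis
    by (simp add: ce_d_wedge_skew forms_def skew_form_alternating wedge_linear)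
qed


section \<open>G2-structures\<close>

text \<open>
  In this section the Lie algebra has dimension 7. A frame is a map \<open>e :: 7 \<Rightarrow> 'a\<close>, and an element of
  the top exterior power is determined by its values on frames.
\<close>

definition frame_list :: "(7 \<Rightarrow> 'a) \<Rightarrow> 'a list" where
  "frame_list e = map (\<lambda>i. e (of_nat i)) [0..<7]"

definition g2_b :: "('a list \<Rightarrow> real) \<Rightarrow> 'a \<Rightarrow> 'a \<Rightarrow> 'a list \<Rightarrow> real" where
  "g2_b \<phi> v w xs = (contract v \<phi> \<and>\<^sub>w contract w \<phi> \<and>\<^sub>w \<phi>) xs / 6"

text \<open>
  The value of the 7-form \<open>det(b\<^sub>\<phi>)\<^sup>1\<^sup>/\<^sup>9\<close> on the frame \<open>e\<close>. If \<open>e\<close> is a basis, the matrix below is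
  \<open>B\<close> with \<open>b\<^sub>\<phi>(e\<^sub>i, e\<^sub>j) = B\<^sub>i\<^sub>j e\<^sup>1 \<and> \<dots> \<and> e\<^sup>7\<close>, because \<open>e\<^sup>1 \<and> \<dots> \<and> e\<^sup>7\<close> takes the value 1 on \<open>e\<close>; if
  \<open>e\<close> is linearly dependent, the matrix vanishes.
\<close>

definition g2_det_root :: "('a list \<Rightarrow> real) \<Rightarrow> (7 \<Rightarrow> 'a) \<Rightarrow> real" where
  "g2_det_root \<phi> e = root 9 (det (\<chi> i j. g2_b \<phi> (e i) (e j) (frame_list e)))"

definition stable_form :: "('a list \<Rightarrow> real) \<Rightarrow> bool" where
  "stable_form \<phi> \<longleftrightarrow> g2_det_root \<phi> \<noteq> (\<lambda>_. 0)"

text \<open>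
  The quotient of two 7-forms is computed on a frame where the denominator does not vanish; it does
  not depend on that frame.
\<close>

definition g2_metric :: "('a list \<Rightarrow> real) \<Rightarrow> 'a \<Rightarrow> 'a \<Rightarrow> real" where
  "g2_metric \<phi> v w =
     (let e = SOME e. g2_det_root \<phi> e \<noteq> 0 in g2_b \<phi> v w (frame_list e) / g2_det_root \<phi> e)"

definition g2_structure :: "('a::real_vector list \<Rightarrow> real) \<Rightarrow> bool" where
  "g2_structure \<phi> \<longleftrightarrow>
     \<phi> \<in> forms 3 \<and> stable_form \<phi> \<and> (\<forall>v. v \<noteq> 0 \<longrightarrow> g2_metric \<phi> v v > 0)"

definition closed_g2_structure :: "('a::real_vector \<Rightarrow> 'a \<Rightarrow> 'a) \<Rightarrow> ('a list \<Rightarrow> real) \<Rightarrow> bool" where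
  "closed_g2_structure br \<phi> \<longleftrightarrow> g2_structure \<phi> \<and> ce_d br \<phi> = (\<lambda>_. 0)"

end

theory Submission
  imports Defs
begin

text \<open>
  Let \<open>e\<^sub>1, e\<^sub>2, e\<^sub>3\<close> be the standard basis of so(3), let \<open>\<phi>\<close> be a closed G2-structure on the product
  with \<open>\<rr>\<close>, and put \<open>A\<^sub>i = \<phi>(e\<^sub>j, e\<^sub>k, _)\<close>, a 1-form on \<open>\<rr>\<close>, for \<open>(i, j, k)\<close> cyclic. Since
  \<open>[e\<^sub>j, e\<^sub>k] = e\<^sub>i\<close>, evaluating \<open>d\<phi>\<close> on \<open>e\<^sub>j, e\<^sub>k\<close> and two vectors of \<open>\<rr>\<close> gives
  \<open>\<phi>(e\<^sub>i, p, q) = - A\<^sub>i [p, q] = dA\<^sub>i (p, q)\<close> (\<open>closed_on_product_mixed\<close>). So the brackets of \<open>\<rr>\<close> control the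
  2-forms \<open>\<iota>\<^sub>x\<phi>\<close> on \<open>\<rr>\<close>, for \<open>x\<close> in so(3).

  The diagonal values \<open>b\<^sub>\<phi>(v, v)\<close>, for \<open>v \<noteq> 0\<close>, are nonzero and have a common sign with respect to a
  volume form. Hence no nonempty sum of such values can vanish, and it is enough to test this on
  one basis (\<open>g2_structure_sum_nonzero\<close>). Three sums are used.

  If the derived algebra \<open>\<nn>\<close> of \<open>\<rr>\<close> has dimension at most 2, then the restrictions of the \<open>A\<^sub>i\<close> to it are
  linearly dependent, so \<open>\<iota>\<^sub>x\<phi>\<close> vanishes on \<open>\<rr>\<close> for some \<open>x \<noteq> 0\<close> in so(3). Such an \<open>x\<close> has
  \<open>b\<^sub>\<phi>(x, x) = 0\<close> (\<open>g2_b_eq_0_degenerate\<close>).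

  Otherwise \<open>\<nn>\<close> has dimension 3 by solvability, and it is abelian or a Heisenberg algebra: it has a basis
  \<open>u, v, z\<close> with \<open>z\<close> central and \<open>[u, v] = t z\<close> (\<open>derived_three_dim_structure\<close>). Let \<open>D\<close> be the action on
  \<open>\<nn>\<close> of a complementary vector \<open>h\<close>. Evaluating \<open>d\<phi>\<close> on \<open>h, u, v, z\<close> gives \<open>tr D \<cdot> \<phi>(u, v, z) = 0\<close>.

  If \<open>\<phi>(u, v, z) = 0\<close>, then every term of \<open>b\<^sub>\<phi>(z, z)\<close> vanishes (\<open>g2_b_eq_0_fibre\<close>). If \<open>tr D = 0\<close>, then \<open>\<rr>\<close>
  is unimodular, so its exact 4-forms vanish, and \<open>\<Sum>\<^sub>i b\<^sub>\<phi>(e\<^sub>i, e\<^sub>i)\<close> is the exterior product of the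
  volume form of so(3) with an exact 4-form of \<open>\<rr>\<close>, a combination of \<open>d(A\<^sub>1 \<and> A\<^sub>2 \<and> A\<^sub>3)\<close> and
  \<open>dA\<^sub>i \<and> dA\<^sub>i\<close> (\<open>g2_b_trace_eq_0\<close>). It is here that so(3) matters: for another real form of its
  complexification the signs in this sum would not be equal.
\<close>

section \<open>Alternating forms\<close>

text \<open>
  Splitting a list at an entry suits inductions along \<open>wedge_Cons\<close> better than updating it.
\<close>

lemma multilinear_form_iff:
  fixes \<omega> :: "'a::real_vector list \<Rightarrow> real"
  shows "multilinear_form \<omega> \<longleftrightarrow> (\<forall>us vs. linear (\<lambda>v. \<omega> (us @ v # vs)))"
proof
  assume *: "multilinear_form \<omega>"
  show "\<forall>us vs. linear (\<lambda>v. \<omega> (us @ v # vs))"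
  proof (intro allI)
    fix us vs :: "'a list"
    show "linear (\<lambda>v. \<omega> (us @ v # vs))"
      using *[unfolded multilinear_form_def, rule_format, of "length us" "us @ 0 # vs"] by simp
  qed
next
  assume *: "\<forall>us vs. linear (\<lambda>v. \<omega> (us @ v # vs))"
  show "multilinear_form \<omega>"
    unfolding multilinear_form_def
  proof (intro allI impI)
    fix xs :: "'a list" and i assume "i < length xs"
    then show "linear (\<lambda>v. \<omega> (xs[i := v]))"
      using * by (simp add: upd_conv_take_nth_drop)
  qed
qed

lemma multilinear_contract: "multilinear_form \<omega> \<Longrightarrow> multilinear_form (contract x \<omega>)"
  unfolding multilinear_form_iff contract_def by (simp flip: append_Cons)

lemma multilinear_grade_sign: "multilinear_form \<omega> \<Longrightarrow> multilinear_form (grade_sign \<omega>)"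
  unfolding multilinear_form_iff grade_sign_def
  by (simp add: linear_iff algebra_simps)

lemma contract_linear:
  assumes "multilinear_form \<omega>"
  shows "contract (x + y) \<omega> = (\<lambda>xs. contract x \<omega> xs + contract y \<omega> xs)"
    and "contract (c *\<^sub>R x) \<omega> = (\<lambda>xs. c * contract x \<omega> xs)"
proof -
  have "linear (\<lambda>v. \<omega> (v # vs))" for vs
    using assms[unfolded multilinear_form_iff, rule_format, of "[]"] by simp
  then show "contract (x + y) \<omega> = (\<lambda>xs. contract x \<omega> xs + contract y \<omega> xs)"
    and "contract (c *\<^sub>R x) \<omega> = (\<lambda>xs. c * contract x \<omega> xs)"
    by (simp_all add: contract_def fun_eq_iff linear_iff)
qed

lemma multilinear_wedge:
  assumes "multilinear_form \<alpha>" "multilinear_form \<beta>"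
  shows "multilinear_form (\<alpha> \<and>\<^sub>w \<beta>)"
proof -
  have "linear (\<lambda>v. (\<alpha> \<and>\<^sub>w \<beta>) (us @ v # vs))" for us vs
    using assms
  proof (induction us arbitrary: \<alpha> \<beta>)
    case Nil
    then show ?case
      by (simp add: linear_iff wedge_Cons contract_linear wedge_linear algebra_simps)
  next
    case (Cons y us)
    show ?case
      using Cons.prems
      by (simp add: wedge_Cons linear_compose_add Cons.IH multilinear_contract
          multilinear_grade_sign)
  qed
  then show ?thesis by (simp add: multilinear_form_iff)
qed

lemma skew_form_permute:
  assumes "skew_form \<omega>" "mset ys = mset xs"
  shows "\<bar>\<omega> ys\<bar> = \<bar>\<omega> xs\<bar>"
  using assms
proof (induction ys arbitrary: \<omega> xs)
  case (Cons y ys)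
  from Cons.prems(2) have "y \<in> set xs"
    by (metis list.set_intros(1) set_mset_mset)
  then obtain us vs where xs: "xs = us @ y # vs"
    by (meson split_list)
  with Cons.prems(2) have "mset ys = mset (us @ vs)"
    by simp
  from Cons.IH[OF skew_contract[OF Cons.prems(1)] this, of y]
  show ?case
    using skew_move[OF Cons.prems(1), of y us vs]
    by (simp add: contract_def xs abs_mult power_abs)
qed simp

lemma skew_form_repeated:
  assumes "skew_form \<omega>" "\<not> distinct xs"
  shows "\<omega> xs = 0"
proof -
  obtain us vs ws y where xs: "xs = us @ [y] @ vs @ [y] @ ws"
    using not_distinct_decomp[OF assms(2)] by blast
  have "\<omega> ([] @ y # y # us @ vs @ ws) = - \<omega> ([] @ y # y # us @ vs @ ws)"
    using assms(1) unfolding skew_form_def by blast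
  moreover have "\<bar>\<omega> xs\<bar> = \<bar>\<omega> (y # y # us @ vs @ ws)\<bar>"
    by (rule skew_form_permute[OF assms(1)]) (simp add: xs)
  ultimately show ?thesis by simp
qed

text \<open>
  Multilinearity reduces the entries of a list to members of the spanning list; such a list
  either repeats an entry or is a rearrangement of the spanning list.
\<close>

lemma form_eq_0_if_0_on_spanning_list:
  assumes "multilinear_form \<omega>" "skew_form \<omega>"
    and "span (set bs) = UNIV" "\<omega> bs = 0" "length xs = length bs"
  shows "\<omega> xs = 0"
proof -
  have "\<omega> (ps @ xs) = 0" if "set ps \<subseteq> set bs" "length (ps @ xs) = length bs" for ps
    using that
  proof (induction xs arbitrary: ps)
    case Nil
    show ?case
    proof (cases "distinct ps")
      case True
      have "card (set ps) = length bs"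
        using True Nil(2) by (simp add: distinct_card)
      moreover from this have card: "card (set bs) = length bs"
        using Nil(1) card_mono[OF _ Nil(1)] card_length[of bs] by simp
      ultimately have "set ps = set bs"
        using Nil(1) by (intro card_subset_eq) auto
      then have "mset ps = mset bs"
        using True card by (simp add: set_eq_iff_mset_eq_distinct[symmetric] card_distinct)
      then show ?thesis
        using skew_form_permute[OF assms(2)] assms(4) by fastforce
    qed (use skew_form_repeated[OF assms(2)] in simp)
  next
    case (Cons x xs)
    have lin: "linear (\<lambda>v. \<omega> (ps @ v # xs))"
      using assms(1) by (simp add: multilinear_form_iff)
    have "\<omega> (ps @ b # xs) = 0" if "b \<in> set bs" for b
      using Cons.IH[of "ps @ [b]"] Cons.prems that by simp
    from linear_eq_0_on_span[OF lin this, of "set bs" x] show ?case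
      using assms(3) by simp
  qed
  from this[of "[]"] assms(5) show ?thesis by simp
qed

lemma span_prod_UNIV:
  fixes S :: "'a::real_vector set" and T :: "'b::real_vector set"
  assumes "span S = UNIV" "span T = UNIV"
  shows "span ((\<lambda>a. (a, 0)) ` S \<union> (\<lambda>b. (0, b)) ` T) = UNIV" (is "span ?U = _")
proof -
  have l: "linear (\<lambda>a::'a. (a, 0::'b))" "linear (\<lambda>b::'b. (0::'a, b))"
    by (auto simp: linear_iff)
  have 1: "(a, 0) \<in> span ?U" for a
    using linear_span_image[OF l(1), of S] assms(1) span_mono[of "(\<lambda>a. (a, 0)) ` S" ?U] by blast
  have 2: "(0, b) \<in> span ?U" for b
    using linear_span_image[OF l(2), of T] assms(2) span_mono[of "(\<lambda>b. (0, b)) ` T" ?U] by blast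
  have "(a, b) \<in> span ?U" for a b
    using span_add[OF 1[of a] 2[of b]] by simp
  then show ?thesis by auto
qed


section \<open>The bilinear form of a G2-structure\<close>

lemma g2_b_multilinear_skew:
  assumes "\<phi> \<in> forms 3"
  shows "multilinear_form (g2_b \<phi> v w)" "skew_form (g2_b \<phi> v w)"
proof -
  have \<phi>: "multilinear_form \<phi>" "skew_form \<phi>"
    using assms by (auto simp: forms_def alternating_form_def intro: skew_form_alternating)
  let ?\<omega> = "contract v \<phi> \<and>\<^sub>w contract w \<phi> \<and>\<^sub>w \<phi>"
  have "multilinear_form ?\<omega>"
    by (intro multilinear_wedge multilinear_contract \<phi>)
  then have "linear (\<lambda>u. ?\<omega> (us @ u # vs))" for us vs
    by (simp add: multilinear_form_iff)
  from linear_compose_scale_right[OF this, of "1 / 6"]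
  show "multilinear_form (g2_b \<phi> v w)"
    by (simp add: multilinear_form_iff g2_b_def)
  have "skew_form ?\<omega>"
    by (intro skew_wedge skew_contract \<phi>)
  then have swap: "?\<omega> (us @ a # b # vs) = - ?\<omega> (us @ b # a # vs)" for us a b vs
    unfolding skew_form_def by blast
  show "skew_form (g2_b \<phi> v w)"
    unfolding skew_form_def g2_b_def
  proof (intro allI)
    fix us a b vs
    show "?\<omega> (us @ a # b # vs) / 6 = - (?\<omega> (us @ b # a # vs) / 6)"
      using swap[of us a b vs] by linarith
  qed
qed

text \<open>
  The numbers \<open>b\<^sub>\<phi>(v, v)\<close>, relative to a fixed volume form, all have the same sign. A sum of
  them is therefore nonzero, and by the previous section this can be tested on any basis.
\<close>

lemma g2_structure_sum_nonzero:
  assumes "g2_structure \<phi>" and bs: "span (set bs) = UNIV" "length bs = 7"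
    and V: "finite V" "V \<noteq> {}" "0 \<notin> V"
  shows "(\<Sum>v\<in>V. g2_b \<phi> v v bs) \<noteq> 0"
proof
  assume 0: "(\<Sum>v\<in>V. g2_b \<phi> v v bs) = 0"
  have \<phi>: "\<phi> \<in> forms 3" and pos: "\<And>v. v \<noteq> 0 \<Longrightarrow> g2_metric \<phi> v v > 0"
    using assms(1) by (auto simp: g2_structure_def)
  define e where "e = (SOME e. g2_det_root \<phi> e \<noteq> 0)"
  have m: "g2_metric \<phi> v w = g2_b \<phi> v w (frame_list e) / g2_det_root \<phi> e" for v w
    by (simp add: g2_metric_def e_def Let_def)
  let ?\<omega> = "\<lambda>xs. \<Sum>v\<in>V. g2_b \<phi> v v xs"
  have multi: "multilinear_form ?\<omega>"
    using g2_b_multilinear_skew(1)[OF \<phi>]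
    by (auto simp: multilinear_form_iff intro!: linear_compose_sum)
  have "g2_b \<phi> v v (us @ a # b # vs) = - g2_b \<phi> v v (us @ b # a # vs)" for v us a b vs
    using g2_b_multilinear_skew(2)[OF \<phi>] unfolding skew_form_def by blast
  then have skew: "skew_form ?\<omega>"
    unfolding skew_form_def sum_negf[symmetric] by (intro allI sum.cong refl)
  from form_eq_0_if_0_on_spanning_list[OF multi skew bs(1) 0, of "frame_list e"]
  have "?\<omega> (frame_list e) = 0"
    by (simp add: bs(2) frame_list_def)
  then have "(\<Sum>v\<in>V. g2_metric \<phi> v v) = 0"
    by (simp add: m flip: sum_divide_distrib)
  moreover have "(\<Sum>v\<in>V. g2_metric \<phi> v v) > 0"
    using V by (intro sum_pos pos) auto
  ultimately show False by simp
qed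


section \<open>Values of the bilinear form on a frame\<close>

text \<open>
  For a factor of low degree the recursion \<open>wedge_Cons\<close> has few nonzero branches: a factor of
  degree 2 reduces a product to one term for each pair of entries. This makes \<open>b\<^sub>\<phi>\<close> computable
  on an explicit frame.
\<close>

definition homogeneous :: "nat \<Rightarrow> ('a list \<Rightarrow> real) \<Rightarrow> bool" where
  "homogeneous k \<omega> \<longleftrightarrow> (\<forall>xs. length xs \<noteq> k \<longrightarrow> \<omega> xs = 0)"

lemma homogeneous_contract: "homogeneous (Suc k) \<omega> \<Longrightarrow> homogeneous k (contract x \<omega>)"
  by (simp add: homogeneous_def contract_def)

lemma grade_sign_homogeneous:
  assumes "homogeneous k \<omega>"
  shows "grade_sign \<omega> = (\<lambda>xs. (-1) ^ k * \<omega> xs)"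
proof
  fix xs
  show "grade_sign \<omega> xs = (-1) ^ k * \<omega> xs"
    using assms by (cases "length xs = k") (simp_all add: homogeneous_def grade_sign_def)
qed

lemma wedge_degree_0:
  assumes "homogeneous 0 \<alpha>"
  shows "(\<alpha> \<and>\<^sub>w \<beta>) xs = \<alpha> [] * \<beta> xs"
proof (induction xs arbitrary: \<beta>)
  case (Cons x xs)
  have "contract x \<alpha> = (\<lambda>xs. 0 * \<alpha> xs)" "grade_sign \<alpha> = \<alpha>"
    using assms grade_sign_homogeneous[OF assms]
    by (simp_all add: homogeneous_def contract_def fun_eq_iff)
  then show ?case
    using wedge_linear(5)[of 0 \<alpha> \<beta> xs] by (simp add: wedge_Cons Cons.IH) (simp add: contract_def)
qed (simp add: wedge_Nil)

lemma wedge_degree_1: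
  assumes "homogeneous 1 \<alpha>"
  shows "(\<alpha> \<and>\<^sub>w \<beta>) (x # xs) = \<alpha> [x] * \<beta> xs - (\<alpha> \<and>\<^sub>w contract x \<beta>) xs"
proof -
  have "grade_sign \<alpha> = (\<lambda>xs. - \<alpha> xs)"
    using grade_sign_homogeneous[OF assms] by simp
  moreover have "homogeneous 0 (contract x \<alpha>)"
    using assms by (simp add: homogeneous_contract)
  ultimately show ?thesis
    by (simp add: wedge_Cons wedge_degree_0 wedge_linear) (simp add: contract_def)
qed

lemma wedge_degree_2:
  assumes "homogeneous 2 \<alpha>"
  shows "(\<alpha> \<and>\<^sub>w \<beta>) (x # xs) = (contract x \<alpha> \<and>\<^sub>w \<beta>) xs + (\<alpha> \<and>\<^sub>w contract x \<beta>) xs"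
proof -
  have "grade_sign \<alpha> = \<alpha>"
    using grade_sign_homogeneous[OF assms] by simp
  then show ?thesis by (simp add: wedge_Cons)
qed

lemma wedge_two_form_on_5:
  assumes "homogeneous 2 \<alpha>"
  shows "(\<alpha> \<and>\<^sub>w \<beta>) [a, b, c, d, e] =
    \<alpha> [a, b] * \<beta> [c, d, e] - \<alpha> [a, c] * \<beta> [b, d, e] + \<alpha> [a, d] * \<beta> [b, c, e]
    - \<alpha> [a, e] * \<beta> [b, c, d] + \<alpha> [b, c] * \<beta> [a, d, e] - \<alpha> [b, d] * \<beta> [a, c, e]
    + \<alpha> [b, e] * \<beta> [a, c, d] + \<alpha> [c, d] * \<beta> [a, b, e] - \<alpha> [c, e] * \<beta> [a, b, d]
    + \<alpha> [d, e] * \<beta> [a, b, c]"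
proof -
  have 1: "homogeneous 1 (contract x \<alpha>)" and 0: "\<alpha> [] = 0" "\<alpha> [x] = 0" for x
    using assms by (auto simp: homogeneous_def contract_def)
  show ?thesis
    unfolding wedge_degree_2[OF assms] wedge_degree_1[OF 1] wedge_Nil
    unfolding contract_def 0
    by (simp only: mult_zero_left diff_conv_add_uminus minus_add_distrib minus_minus minus_zero
        add_0_right add_0_left add.assoc)
qed

lemma wedge_two_form_on_7:
  assumes "homogeneous 2 \<alpha>"
  shows "(\<alpha> \<and>\<^sub>w \<beta>) [a, b, c, d, e, f, g] =
    \<alpha> [a, b] * \<beta> [c, d, e, f, g] - \<alpha> [a, c] * \<beta> [b, d, e, f, g] + \<alpha> [a, d] * \<beta> [b, c, e, f, g]
    - \<alpha> [a, e] * \<beta> [b, c, d, f, g] + \<alpha> [a, f] * \<beta> [b, c, d, e, g] - \<alpha> [a, g] * \<beta> [b, c, d, e, f]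
    + \<alpha> [b, c] * \<beta> [a, d, e, f, g] - \<alpha> [b, d] * \<beta> [a, c, e, f, g] + \<alpha> [b, e] * \<beta> [a, c, d, f, g]
    - \<alpha> [b, f] * \<beta> [a, c, d, e, g] + \<alpha> [b, g] * \<beta> [a, c, d, e, f] + \<alpha> [c, d] * \<beta> [a, b, e, f, g]
    - \<alpha> [c, e] * \<beta> [a, b, d, f, g] + \<alpha> [c, f] * \<beta> [a, b, d, e, g] - \<alpha> [c, g] * \<beta> [a, b, d, e, f]
    + \<alpha> [d, e] * \<beta> [a, b, c, f, g] - \<alpha> [d, f] * \<beta> [a, b, c, e, g] + \<alpha> [d, g] * \<beta> [a, b, c, e, f]
    + \<alpha> [e, f] * \<beta> [a, b, c, d, g] - \<alpha> [e, g] * \<beta> [a, b, c, d, f] + \<alpha> [f, g] * \<beta> [a, b, c, d, e]"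
proof -
  have 1: "homogeneous 1 (contract x \<alpha>)" and 0: "\<alpha> [] = 0" "\<alpha> [x] = 0" for x
    using assms by (auto simp: homogeneous_def contract_def)
  show ?thesis
    unfolding wedge_degree_2[OF assms] wedge_degree_1[OF 1] wedge_Nil
    unfolding contract_def 0
    by (simp only: mult_zero_left diff_conv_add_uminus minus_add_distrib minus_minus minus_zero
        add_0_right add_0_left add.assoc)
qed

lemma three_form_swap:
  assumes "\<phi> \<in> forms 3"
  shows "\<phi> [x, y, z] = - \<phi> [y, x, z]" "\<phi> [x, y, z] = - \<phi> [x, z, y]"
    "\<phi> [x, x, z] = 0" "\<phi> [x, y, y] = 0" "\<phi> [x, y, x] = 0"
proof -
  have sk: "skew_form \<phi>"
    using assms by (auto simp: forms_def intro: skew_form_alternating)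
  show "\<phi> [x, y, z] = - \<phi> [y, x, z]"
    using sk unfolding skew_form_def by (metis append_Nil)
  show "\<phi> [x, y, z] = - \<phi> [x, z, y]"
    using sk unfolding skew_form_def by (metis append_Nil append_Cons)
  show "\<phi> [x, x, z] = 0" "\<phi> [x, y, y] = 0" "\<phi> [x, y, x] = 0"
    by (auto intro: skew_form_repeated[OF sk])
qed

lemma homogeneous_contract_three_form:
  "\<phi> \<in> forms 3 \<Longrightarrow> homogeneous 2 (contract v \<phi>)"
  by (auto simp: forms_def homogeneous_def contract_def)

text \<open>
  If \<open>\<iota>\<^sub>x\<phi>\<close> vanishes on the span \<open>R\<close> of \<open>h, u, v, w\<close>, then it is nonzero only on pairs that contain \<open>y\<close> or \<open>z\<close>. In a
  term of \<open>b\<^sub>\<phi>(x, x)\<close> the two factors \<open>\<iota>\<^sub>x\<phi>\<close> then use up \<open>y\<close> and \<open>z\<close>, and \<open>x\<close> cannot be an argument of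
  either, so the third factor is the value of \<open>\<phi>\<close> on \<open>x\<close> and two vectors of \<open>R\<close>.
\<close>

lemma g2_b_eq_0_degenerate:
  assumes \<phi>: "\<phi> \<in> forms 3"
    and 0: "\<And>p q. p \<in> {h, u, v, w} \<Longrightarrow> q \<in> {h, u, v, w} \<Longrightarrow> \<phi> [x, p, q] = 0"
  shows "g2_b \<phi> x x [x, y, z, h, u, v, w] = 0"
  unfolding g2_b_def
  by (simp add: wedge_two_form_on_7 wedge_two_form_on_5 homogeneous_contract_three_form[OF \<phi>] contract_def
      0 three_form_swap(3-5)[OF \<phi>])

text \<open>
  By hypothesis \<open>\<iota>\<^sub>w\<phi>\<close> pairs \<open>u\<close> and \<open>v\<close> only with \<open>h\<close>. So the two factors \<open>\<iota>\<^sub>w\<phi>\<close> in a term of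
  \<open>b\<^sub>\<phi>(w, w)\<close> take at most one of \<open>u, v\<close>, and with it \<open>h\<close>; they do not take \<open>w\<close>. The third factor is then
  either \<open>\<phi>(u, v, w)\<close>, or the value of \<open>\<phi>\<close> on one of \<open>x, y, z\<close>, one of \<open>u, v\<close>, and \<open>w\<close>.
\<close>

lemma g2_b_eq_0_fibre:
  assumes \<phi>: "\<phi> \<in> forms 3"
    and 0: "\<And>e p. e \<in> {x, y, z} \<Longrightarrow> p \<in> {u, v} \<Longrightarrow> \<phi> [e, p, w] = 0" "\<phi> [u, v, w] = 0"
  shows "g2_b \<phi> w w [x, y, z, h, u, v, w] = 0"
proof -
  have 1: "\<phi> [w, p, q] = \<phi> [p, q, w]" for p q
    using three_form_swap[OF \<phi>] by metis
  show ?thesis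
  unfolding g2_b_def
  by (simp add: wedge_two_form_on_7 wedge_two_form_on_5 homogeneous_contract_three_form[OF \<phi>] contract_def
      0 1 three_form_swap(3-5)[OF \<phi>])
qed

text \<open>
  In terms of the 1-forms \<open>A = \<iota>\<^sub>y\<iota>\<^sub>x\<phi>\<close>, \<open>C = \<iota>\<^sub>x\<iota>\<^sub>z\<phi>\<close> and the 2-form \<open>W = \<iota>\<^sub>x\<phi>\<close> on the
  span of \<open>h, u, v, w\<close>, this says that \<open>b\<^sub>\<phi>(x, x)\<close> is \<open>A \<and> C \<and> W + \<phi>(x, y, z) W \<and> W / 2\<close>.
\<close>

lemma g2_b_leading_vector:
  assumes \<phi>: "\<phi> \<in> forms 3"
  shows "g2_b \<phi> x x [x, y, z, h, u, v, w] =
    (let A = \<lambda>i. \<phi> [x, y, i]; C = \<lambda>i. \<phi> [z, x, i]; W = \<lambda>i j. \<phi> [x, i, j];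
       M = \<lambda>i j. A i * C j - A j * C i in
     M h u * W v w - M h v * W u w + M h w * W u v + M u v * W h w - M u w * W h v + M v w * W h u
     + \<phi> [x, y, z] * (W h u * W v w - W h v * W u w + W h w * W u v))"
proof -
  have zx: "\<phi> [z, x, i] = - \<phi> [x, z, i]" for i
    by (rule three_form_swap[OF \<phi>])
  show ?thesis
    unfolding g2_b_def Let_def zx
    by (simp add: wedge_two_form_on_7 wedge_two_form_on_5 homogeneous_contract_three_form[OF \<phi>]
        contract_def three_form_swap(3-5)[OF \<phi>] algebra_simps add_divide_distrib diff_divide_distrib)
qed

text \<open>
  The hypotheses say that \<open>\<iota>\<^sub>x\<phi> = dA\<close> with \<open>A = \<phi>(y, z, _)\<close>, for the Lie algebra spanned by \<open>h, u, v, w\<close>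
  in which \<open>h\<close> acts by the matrix \<open>d\<^sub>i\<^sub>j\<close> and \<open>[u, v] = t w\<close>. The conditions on \<open>t\<close> are its Jacobi identity;
  together with the trace condition they give \<open>t d\<^sub>3\<^sub>j = 0\<close> for all \<open>j\<close>, hence \<open>dA \<and> dA = 0\<close>. The other
  terms sum, up to sign, to \<open>d(A\<^sub>1 \<and> A\<^sub>2 \<and> A\<^sub>3)\<close>, which is the trace of the matrix times the
  determinant of \<open>A\<^sub>1, A\<^sub>2, A\<^sub>3\<close> on \<open>u, v, w\<close>, again up to sign.
\<close>

lemma g2_b_trace_eq_0:
  assumes \<phi>: "\<phi> \<in> forms 3"
    and W: "\<And>x y z. (x, y, z) \<in> {(e1, e2, e3), (e2, e3, e1), (e3, e1, e2)} \<Longrightarrow>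
        \<phi> [x, h, u] = - (d11 * \<phi> [y, z, u] + d12 * \<phi> [y, z, v] + d13 * \<phi> [y, z, w]) \<and>
        \<phi> [x, h, v] = - (d21 * \<phi> [y, z, u] + d22 * \<phi> [y, z, v] + d23 * \<phi> [y, z, w]) \<and>
        \<phi> [x, h, w] = - (d31 * \<phi> [y, z, u] + d32 * \<phi> [y, z, v] + d33 * \<phi> [y, z, w]) \<and>
        \<phi> [x, u, v] = - (t * \<phi> [y, z, w]) \<and> \<phi> [x, u, w] = 0 \<and> \<phi> [x, v, w] = 0"
    and trace: "d11 + d22 + d33 = 0"
    and t: "t * d31 = 0" "t * d32 = 0" "t * d33 = t * (d11 + d22)"
  shows "g2_b \<phi> e1 e1 [e1, e2, e3, h, u, v, w] + g2_b \<phi> e2 e2 [e1, e2, e3, h, u, v, w]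
    + g2_b \<phi> e3 e3 [e1, e2, e3, h, u, v, w] = 0"
proof -
  have swap: "g2_b \<phi> x x (us @ a # b # vs) = - g2_b \<phi> x x (us @ b # a # vs)" for x us a b vs
    using g2_b_multilinear_skew(2)[OF \<phi>] unfolding skew_form_def by blast
  \<comment> \<open>cyclic rotations of the first three vectors are even, so each \<open>e\<^sub>i\<close> can be moved to the front\<close>
  have c2: "g2_b \<phi> e2 e2 [e1, e2, e3, h, u, v, w] = g2_b \<phi> e2 e2 [e2, e3, e1, h, u, v, w]"
    using swap[of e2 "[]" e1 e2] swap[of e2 "[e2]" e1 e3] by simp
  have c3: "g2_b \<phi> e3 e3 [e1, e2, e3, h, u, v, w] = g2_b \<phi> e3 e3 [e3, e1, e2, h, u, v, w]"
    using swap[of e3 "[e1]" e2 e3] swap[of e3 "[]" e1 e3] by simp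
  have "t * d33 = 0" using t(3) trace by algebra
  then have vol: "d31 * (t * a) = 0" "d32 * (t * a) = 0" "d11 * (t * a) = - (d22 * (t * a))" for a
    using t by algebra+
  have d33: "d33 = - d11 - d22" using trace by simp
  note W1 = W[of e1 e2 e3, simplified] and W2 = W[of e2 e3 e1, simplified] and W3 = W[of e3 e1 e2, simplified]
  show ?thesis
    unfolding c2 c3 g2_b_leading_vector[OF \<phi>] Let_def
    by (simp add: W1 W2 W3 vol d33 algebra_simps)
qed


section \<open>Closed 3-forms on a product\<close>

lemma three_form_linear:
  assumes "\<phi> \<in> forms 3"
  shows "linear (\<lambda>a. \<phi> [a, b, c])" "linear (\<lambda>a. \<phi> [b, a, c])" "linear (\<lambda>a. \<phi> [b, c, a])"
proof -
  have "linear (\<lambda>v. \<phi> (us @ v # vs))" for us vs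
    using assms by (simp add: forms_def alternating_form_def multilinear_form_iff)
  from this[of "[]" "[b, c]"] this[of "[b]" "[c]"] this[of "[b, c]" "[]"]
  show "linear (\<lambda>a. \<phi> [a, b, c])" "linear (\<lambda>a. \<phi> [b, a, c])" "linear (\<lambda>a. \<phi> [b, c, a])"
    by simp_all
qed

lemma ce_d_three_form:
  "ce_d br \<omega> [a, b, c, d] =
    - \<omega> [br a b, c, d] + \<omega> [br a c, b, d] - \<omega> [br a d, b, c]
    - \<omega> [br b c, a, d] + \<omega> [br b d, a, c] - \<omega> [br c d, a, b]"
  by (simp add: ce_d_def nths_Cons lessThan_Suc eval_nat_numeral)

text \<open>
  Brackets between the two factors vanish. So when \<open>d\<phi>\<close> is evaluated on two vectors from each factor,
  only two of its six terms remain; four vectors from the second factor give its differential there.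
\<close>

lemma closed_on_product:
  assumes br1: "lie_algebra br1" and br2: "lie_algebra br2"
    and \<phi>: "\<phi> \<in> forms 3" and closed: "ce_d (lie_prod br1 br2) \<phi> = (\<lambda>_. 0)"
  shows closed_on_product_mixed:
      "\<phi> [(br1 x y, 0), (0, u), (0, v)] = - \<phi> [(x, 0), (y, 0), (0, br2 u v)]"
    and closed_on_product_vertical:
      "\<phi> [(0, br2 h u), (0, v), (0, w)] - \<phi> [(0, br2 h v), (0, u), (0, w)]
       + \<phi> [(0, br2 h w), (0, u), (0, v)] + \<phi> [(0, br2 u v), (0, h), (0, w)]
       - \<phi> [(0, br2 u w), (0, h), (0, v)] + \<phi> [(0, br2 v w), (0, h), (0, u)] = 0"
proof -
  note zero = bilinear_lzero[OF lie_algebra.bilinear_br] bilinear_rzero[OF lie_algebra.bilinear_br]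
  have \<phi>0: "\<phi> [(0, 0), b, c] = 0" for b c
    using linear_0[OF three_form_linear(1)[OF \<phi>]] by (simp add: zero_prod_def)
  have rot: "\<phi> [c, a, b] = \<phi> [a, b, c]" for a b c
    using three_form_swap(1,2)[OF \<phi>] by metis
  show "\<phi> [(br1 x y, 0), (0, u), (0, v)] = - \<phi> [(x, 0), (y, 0), (0, br2 u v)]"
    using fun_cong[OF closed, of "[(x, 0), (y, 0), (0, u), (0, v)]"] rot[of "(0, br2 u v)" "(x, 0)" "(y, 0)"]
    by (simp add: ce_d_three_form lie_prod_def zero[OF br1] zero[OF br2] \<phi>0)
  show "\<phi> [(0, br2 h u), (0, v), (0, w)] - \<phi> [(0, br2 h v), (0, u), (0, w)]
       + \<phi> [(0, br2 h w), (0, u), (0, v)] + \<phi> [(0, br2 u v), (0, h), (0, w)]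
       - \<phi> [(0, br2 u w), (0, h), (0, v)] + \<phi> [(0, br2 v w), (0, h), (0, u)] = 0"
    using fun_cong[OF closed, of "[(0, h), (0, u), (0, v), (0, w)]"]
    by (simp add: ce_d_three_form lie_prod_def zero[OF br1] zero[OF br2])
qed


section \<open>Four-dimensional solvable Lie algebras\<close>

lemma span2_iff: "x \<in> span {a, b} \<longleftrightarrow> (\<exists>p q. x = p *\<^sub>R a + q *\<^sub>R b)"
  by (auto simp: span_breakdown_eq algebra_simps)

lemma span3_iff: "x \<in> span {a, b, c} \<longleftrightarrow> (\<exists>p q r. x = p *\<^sub>R a + q *\<^sub>R b + r *\<^sub>R c)"
  by (auto simp: span_breakdown_eq algebra_simps)

context lie_algebra
begin

lemmas br_linear =
  bilinear_ladd[OF bilinear_br] bilinear_radd[OF bilinear_br]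
  bilinear_lmul[OF bilinear_br] bilinear_rmul[OF bilinear_br]
  bilinear_lzero[OF bilinear_br] bilinear_rzero[OF bilinear_br]
  bilinear_lneg[OF bilinear_br] bilinear_rneg[OF bilinear_br]

lemma linear_br: "linear (br x)" "linear (\<lambda>x. br x y)"
  using bilinear_br by (simp_all add: bilinear_def)

lemma br_skew: "br y x = - br x y"
proof -
  have "br x y + br y x = br (x + y) (x + y)"
    by (simp only: br_linear(1,2)) (simp add: br_self)
  also have "\<dots> = 0" by (rule br_self)
  finally show ?thesis by (rule minus_unique[symmetric])
qed

lemma br_derivation: "br x (br y z) = br (br x y) z + br y (br x z)"
proof -
  have "br z (br x y) = - br (br x y) z" "br y (br z x) = - br y (br x z)"
    using br_skew[of z "br x y"] br_skew[of x z] by (simp_all add: br_linear)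
  with jacobi[of x y z] show ?thesis by (simp add: algebra_simps)
qed

lemma subspace_derived_series: "subspace (derived_series br n)"
  by (cases n) auto

lemma br_in_derived_Suc:
  "x \<in> derived_series br n \<Longrightarrow> y \<in> derived_series br n \<Longrightarrow> br x y \<in> derived_series br (Suc n)"
  by (auto intro: span_base)

lemma derived_series_ideal: "x \<in> derived_series br n \<Longrightarrow> br v x \<in> derived_series br n"
proof (induction n arbitrary: x)
  case (Suc n)
  have "subspace {x. br v x \<in> derived_series br (Suc n)}"
    using linear_subspace_vimage[OF linear_br(1) subspace_derived_series[of "Suc n"], of v]
    unfolding vimage_def .
  moreover have "br v (br x y) \<in> derived_series br (Suc n)"
    if "x \<in> derived_series br n" "y \<in> derived_series br n" for x y
    unfolding br_derivation[of v x y]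
    using Suc.IH[OF that(1)] Suc.IH[OF that(2)] that
    by (intro subspace_add subspace_derived_series br_in_derived_Suc)
  ultimately show ?case
    using span_induct[OF Suc.prems[unfolded derived_series.simps], of "\<lambda>x. br v x \<in> derived_series br (Suc n)"]
    by blast
qed simp

lemma derived_series_Suc_subset: "derived_series br (Suc n) \<subseteq> derived_series br n"
  unfolding derived_series.simps(2)
  by (rule span_minimal) (auto intro: derived_series_ideal subspace_derived_series)

lemma solvable_derived_series_strict:
  assumes "lie_solvable br" "derived_series br n \<noteq> {0}"
  shows "derived_series br (Suc n) \<noteq> derived_series br n"
proof
  assume eq: "derived_series br (Suc n) = derived_series br n"
  have const: "derived_series br (n + k) = derived_series br n" for k
  proof (induction k)
    case (Suc k)
    then show ?case using eq by simp
  qed simp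
  obtain m where m: "derived_series br m = {0}"
    using assms(1) by (auto simp: lie_solvable_def)
  have "derived_series br (m + n) \<subseteq> derived_series br m"
    by (induction n) (use derived_series_Suc_subset in \<open>auto simp del: derived_series.simps\<close>)
  with const[of m] m assms(2) show False
    using subspace_0[OF subspace_derived_series[of n]] by (auto simp: add.commute)
qed

text \<open>
  A one-dimensional ideal gives a character of the Lie algebra, and characters vanish on
  commutators.
\<close>

lemma ideal_line_centralized:
  assumes "\<And>v. br v z \<in> span {z}" and "v \<in> derived_series br (Suc 0)"
  shows "br v z = 0"
proof -
  from assms(1) have "\<forall>v. \<exists>c. br v z = c *\<^sub>R z"
    by (auto simp: span_breakdown_eq)
  then obtain c where c: "\<And>v. br v z = c v *\<^sub>R z"
    by metis
  have "br (br x y) z = 0" for x y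
    using br_derivation[of x y z] by (simp add: c br_linear mult.commute)
  moreover have "v \<in> span {br x y | x y. True}"
    using assms(2) by simp
  ultimately show ?thesis
    using linear_eq_0_on_span[OF linear_br(2), of "{br x y | x y. True}" z v] by blast
qed

text \<open>
  The plane spanned by \<open>y, y'\<close> is abelian: otherwise its derived algebra is a one-dimensional ideal
  on which \<open>y\<close> and \<open>y'\<close> act trivially by \<open>ideal_line_centralized\<close>, which forces \<open>[y, y'] = 0\<close>.
  Hence \<open>x\<close> acts on the plane by an invertible operator \<open>M\<close>, because the plane is spanned by
  \<open>[x, y]\<close> and \<open>[x, y']\<close>. If \<open>h\<close> acts on it by \<open>D\<close>, and \<open>[h, x] = \<lambda> x\<close> modulo the plane, then
  \<open>D M - M D = \<lambda> M\<close> by the Jacobi identity. Multiplying by the inverse of \<open>M\<close> and taking traces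
  gives \<open>2 \<lambda> = 0\<close>. But then all commutators lie in the plane, whereas \<open>x\<close>, a sum of commutators,
  does not.
\<close>

lemma second_derived_not_plane:
  assumes all: "span {h, x, y, y'} = UNIV"
    and N: "derived_series br (Suc 0) = span {x, y, y'}"
    and N': "derived_series br (Suc (Suc 0)) = span {y, y'}"
    and indep: "\<And>a b. a *\<^sub>R y + b *\<^sub>R y' = 0 \<Longrightarrow> a = 0 \<and> b = 0"
    and x: "x \<notin> span {y, y'}"
  shows False
proof -
  have coeffs: "a = a' \<and> b = b'" if "a *\<^sub>R y + b *\<^sub>R y' = a' *\<^sub>R y + b' *\<^sub>R y'" for a b a' b'
    using indep[of "a - a'" "b - b'"] that by (simp add: algebra_simps)
  have yN: "y \<in> span {y, y'}" "y' \<in> span {y, y'}"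
    by (auto intro: span_base)
  have ideal: "br v w \<in> span {y, y'}" if "w \<in> span {y, y'}" for v w
    using derived_series_ideal[of w "Suc (Suc 0)" v] that unfolding N' .
  obtain p q where pq: "br y y' = p *\<^sub>R y + q *\<^sub>R y'"
    using ideal[OF yN(2)] unfolding span2_iff by blast
  obtain m11 m12 where m1: "br x y = m11 *\<^sub>R y + m12 *\<^sub>R y'"
    using ideal[OF yN(1)] unfolding span2_iff by blast
  obtain m21 m22 where m2: "br x y' = m21 *\<^sub>R y + m22 *\<^sub>R y'"
    using ideal[OF yN(2)] unfolding span2_iff by blast
  obtain d11 d12 where d1: "br h y = d11 *\<^sub>R y + d12 *\<^sub>R y'"
    using ideal[OF yN(1)] unfolding span2_iff by blast
  obtain d21 d22 where d2: "br h y' = d21 *\<^sub>R y + d22 *\<^sub>R y'"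
    using ideal[OF yN(2)] unfolding span2_iff by blast
  have "x \<in> derived_series br (Suc 0)"
    unfolding N by (simp add: span_base)
  from derived_series_ideal[OF this, of h]
  obtain l k k' where l: "br h x = l *\<^sub>R x + k *\<^sub>R y + k' *\<^sub>R y'"
    unfolding N span3_iff by blast

  have abelian: "br y y' = 0"
  proof (rule ccontr)
    assume nz: "br y y' \<noteq> 0"
    let ?z = "br y y'"
    have "br a b \<in> span {?z}" if ab: "a \<in> span {y, y'}" "b \<in> span {y, y'}" for a b
    proof -
      obtain a1 a2 b1 b2 where "a = a1 *\<^sub>R y + a2 *\<^sub>R y'" "b = b1 *\<^sub>R y + b2 *\<^sub>R y'"
        using ab unfolding span2_iff by blast
      then have "br a b = (a1 * b2 - a2 * b1) *\<^sub>R ?z"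
        using br_skew[of y' y] by (simp add: br_linear br_self algebra_simps)
      then show ?thesis by (simp add: span_base span_scale)
    qed
    then have N'': "derived_series br (Suc (Suc (Suc 0))) \<subseteq> span {?z}"
      unfolding derived_series.simps(2)[of br "Suc (Suc 0)"] N' by (intro span_minimal) auto
    have "?z \<in> derived_series br (Suc (Suc (Suc 0)))"
      using yN unfolding N'[symmetric] by (rule br_in_derived_Suc)
    then have "br v ?z \<in> span {?z}" for v
      using derived_series_ideal N'' by blast
    from ideal_line_centralized[OF this] have c: "br v ?z = 0" if "v \<in> span {y, y'}" for v
      using that derived_series_Suc_subset[of "Suc 0"] unfolding N' by blast
    have "br y ?z = q *\<^sub>R ?z"
      using arg_cong[OF pq, of "br y"] by (simp add: br_linear br_self)
    moreover have "br y' ?z = - p *\<^sub>R ?z"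
      using arg_cong[OF pq, of "br y'"] br_skew[of y' y] by (simp add: br_linear br_self)
    ultimately have "p = 0 \<and> q = 0"
      using c[OF yN(1)] c[OF yN(2)] nz by simp
    with pq nz show False by simp
  qed
  then have abelian': "br y' y = 0"
    using br_skew[of y' y] by simp

  have "l \<noteq> 0"
  proof
    assume "l = 0"
    with l have hx: "br h x \<in> span {y, y'}"
      unfolding span2_iff by auto
    have "br a b \<in> span {y, y'}" for a b
    proof -
      have "\<exists>r s w. a = r *\<^sub>R h + s *\<^sub>R x + w \<and> w \<in> span {y, y'}" for a
      proof -
        have "a \<in> span {h, x, y, y'}" using all by simp
        then obtain r s where "a - r *\<^sub>R h - s *\<^sub>R x \<in> span {y, y'}"
          unfolding span_breakdown_eq[of a h] span_breakdown_eq[of _ x] by blast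
        then show ?thesis
          by (intro exI[of _ r] exI[of _ s] exI[of _ "a - r *\<^sub>R h - s *\<^sub>R x"]) simp
      qed
      then obtain r s w r' s' w' where a: "a = r *\<^sub>R h + s *\<^sub>R x + w" "w \<in> span {y, y'}"
        and b: "b = r' *\<^sub>R h + s' *\<^sub>R x + w'" "w' \<in> span {y, y'}"
        by meson
      have "br a b = (r * s' - s * r') *\<^sub>R br h x + br a w' - br (r' *\<^sub>R h + s' *\<^sub>R x) w"
        using br_skew[of h x] br_skew[of w h] br_skew[of w x]
        by (simp add: a(1) b(1) br_linear br_self algebra_simps)
      then show ?thesis
        using ideal[OF a(2)] ideal[OF b(2)] hx by (simp add: span_add span_diff span_scale)
    qed
    then have "derived_series br (Suc 0) \<subseteq> span {y, y'}"
      unfolding derived_series.simps(2) by (intro span_minimal) auto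
    then show False
      using x \<open>x \<in> derived_series br (Suc 0)\<close> by blast
  qed

  \<comment> \<open>the coordinates of \<open>y, y'\<close> in terms of \<open>[x, y], [x, y']\<close> are an inverse of the matrix \<open>m\<close>\<close>
  have det: "m11 * m22 - m12 * m21 \<noteq> 0"
  proof -
    have "br a b \<in> span {br x y, br x y'}" if ab: "a \<in> span {x, y, y'}" "b \<in> span {x, y, y'}" for a b
    proof -
      obtain a0 a1 a2 b0 b1 b2 where "a = a0 *\<^sub>R x + a1 *\<^sub>R y + a2 *\<^sub>R y'"
        and "b = b0 *\<^sub>R x + b1 *\<^sub>R y + b2 *\<^sub>R y'"
        using ab unfolding span3_iff by blast
      then have "br a b = (a0 * b1 - a1 * b0) *\<^sub>R br x y + (a0 * b2 - a2 * b0) *\<^sub>R br x y'"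
        using br_skew[of y x] br_skew[of y' x]
        by (simp add: br_linear br_self abelian abelian' algebra_simps)
      then show ?thesis unfolding span2_iff by blast
    qed
    then have "derived_series br (Suc (Suc 0)) \<subseteq> span {br x y, br x y'}"
      unfolding derived_series.simps(2)[of br "Suc 0"] N by (intro span_minimal) auto
    then have "y \<in> span {br x y, br x y'}" "y' \<in> span {br x y, br x y'}"
      using yN unfolding N' by blast+
    then obtain a b c d where
      "y = a *\<^sub>R br x y + b *\<^sub>R br x y'" "y' = c *\<^sub>R br x y + d *\<^sub>R br x y'"
      unfolding span2_iff by blast
    then have "1 *\<^sub>R y + 0 *\<^sub>R y' = (a * m11 + b * m21) *\<^sub>R y + (a * m12 + b * m22) *\<^sub>R y'"
      and "0 *\<^sub>R y + 1 *\<^sub>R y' = (c * m11 + d * m21) *\<^sub>R y + (c * m12 + d * m22) *\<^sub>R y'"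
      unfolding m1 m2 by (simp_all add: algebra_simps)
    from coeffs[OF this(1)] coeffs[OF this(2)]
    have "(a * d - b * c) * (m11 * m22 - m12 * m21) = 1"
      by algebra
    then show ?thesis by auto
  qed

  have "br h (br x y) = br (br h x) y + br x (br h y)"
    by (rule br_derivation)
  then have "(m11 * d11 + m12 * d21) *\<^sub>R y + (m11 * d12 + m12 * d22) *\<^sub>R y'
    = (l * m11 + d11 * m11 + d12 * m21) *\<^sub>R y + (l * m12 + d11 * m12 + d12 * m22) *\<^sub>R y'"
    by (simp add: m1 m2 d1 d2 l br_linear br_self abelian' algebra_simps)
  note e1 = coeffs[OF this]
  have "br h (br x y') = br (br h x) y' + br x (br h y')"
    by (rule br_derivation)
  then have "(m21 * d11 + m22 * d21) *\<^sub>R y + (m21 * d12 + m22 * d22) *\<^sub>R y'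
    = (l * m21 + d21 * m11 + d22 * m21) *\<^sub>R y + (l * m22 + d21 * m12 + d22 * m22) *\<^sub>R y'"
    by (simp add: m1 m2 d1 d2 l br_linear br_self abelian algebra_simps)
  note e2 = coeffs[OF this]
  \<comment> \<open>the trace of the adjugate of \<open>m\<close> times the equations \<open>m d - d m = l m\<close>\<close>
  have "2 * l * (m11 * m22 - m12 * m21) = 0"
    using e1 e2 by algebra
  with det \<open>l \<noteq> 0\<close> show False by simp
qed

text \<open>
  If the second derived algebra is zero, any nonzero \<open>z\<close> in the first one will do. If it is a line, \<open>z\<close> spans
  it, and \<open>ideal_line_centralized\<close> makes \<open>z\<close> central. The conditions on \<open>t\<close> express that \<open>h\<close> acts as a
  derivation on \<open>[u, v] = t z\<close>. Stating them as products covers \<open>t = 0\<close>, where \<open>h\<close> may act arbitrarily.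
\<close>

lemma derived_three_dim_structure:
  assumes dim: "dim (UNIV :: 'a set) = 4" and solv: "lie_solvable br"
    and large: "\<And>p q. \<not> derived_series br (Suc 0) \<subseteq> span {p, q}"
  obtains h u v z d11 d12 d13 d21 d22 d23 d31 d32 d33 t where
    "span {h, u, v, z} = UNIV" "z \<noteq> 0"
    "br u z = 0" "br v z = 0" "br u v = t *\<^sub>R z"
    "br h u = d11 *\<^sub>R u + d12 *\<^sub>R v + d13 *\<^sub>R z"
    "br h v = d21 *\<^sub>R u + d22 *\<^sub>R v + d23 *\<^sub>R z"
    "br h z = d31 *\<^sub>R u + d32 *\<^sub>R v + d33 *\<^sub>R z"
    "t * d31 = 0" "t * d32 = 0" "t * d33 = t * (d11 + d22)"
proof -
  let ?N = "derived_series br (Suc 0)" and ?N' = "derived_series br (Suc (Suc 0))"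
  note derived_series.simps [simp del]
  have "UNIV \<noteq> {0 :: 'a}"
    using dim dim_le_card[of "UNIV :: 'a set" "{}"] by auto
  then have N: "?N \<noteq> UNIV"
    using solvable_derived_series_strict[OF solv, of 0] by (simp add: derived_series.simps(1))
  have "{0} \<subseteq> span {0, 0}" by (simp add: span_zero)
  with large have "?N \<noteq> {0}" by metis
  then have N': "?N' \<noteq> ?N"
    using solvable_derived_series_strict[OF solv] by blast
  have sub: "?N' \<subseteq> ?N" by (rule derived_series_Suc_subset)
  \<comment> \<open>bases \<open>S' \<subseteq> S \<subseteq> B\<close> adapted to \<open>N' \<subseteq> N \<subseteq> UNIV\<close>\<close>
  obtain S' where S': "S' \<subseteq> ?N'" "independent S'" "?N' \<subseteq> span S'"
    by (rule maximal_independent_subset)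
  obtain S where S: "S' \<subseteq> S" "S \<subseteq> ?N" "independent S" "?N \<subseteq> span S"
    by (rule maximal_independent_subset_extend[OF order.trans[OF S'(1) sub] S'(2)])
  obtain B where B: "S \<subseteq> B" "B \<subseteq> UNIV" "independent B" "UNIV \<subseteq> span B"
    by (rule maximal_independent_subset_extend[OF subset_UNIV S(3)])
  have cB: "card B = 4"
    using basis_card_eq_dim[of B UNIV] B dim by simp
  then have fB: "finite B" by (metis card.infinite zero_neq_numeral)
  then have fS: "finite S" using B(1) finite_subset by blast
  have spS: "span S = ?N" and spS': "span S' = ?N'"
    using subset_antisym[OF span_minimal[OF S(2) subspace_derived_series] S(4)]
      subset_antisym[OF span_minimal[OF S'(1) subspace_derived_series] S'(3)] .
  have "S \<noteq> B" using B(4) spS N by blast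
  then have "card S < 4"
    using B(1) fB cB psubset_card_mono[of B S] by auto
  moreover have "\<not> card S \<le> 2"
  proof
    assume "card S \<le> 2"
    then obtain p q where "S \<subseteq> {p, q}"
    proof -
      have "card S = 0 \<or> card S = 1 \<or> card S = 2" using \<open>card S \<le> 2\<close> by auto
      then show ?thesis
        using fS that by (auto simp: card_1_singleton_iff card_2_iff)
    qed
    then have "?N \<subseteq> span {p, q}"
      unfolding spS[symmetric] by (rule span_mono)
    with large show False by blast
  qed
  ultimately have cS: "card S = 3" by simp
  have "card (B - S) = 1"
    using card_Diff_subset[OF fS B(1)] cB cS by simp
  then obtain h where h: "B - S = {h}" by (auto simp: card_1_singleton_iff)
  then have Bh: "B = insert h S" using B(1) by blast
  have "S' \<noteq> S" using spS spS' N' by blast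
  then have "card S' < 3"
    using S(1) fS cS psubset_card_mono[of S S'] by auto
  have fS': "finite S'" using S(1) fS finite_subset by blast

  have "card S' \<noteq> 2"
  proof
    assume c2: "card S' = 2"
    then obtain y y' where y: "S' = {y, y'}" "y \<noteq> y'" by (auto simp: card_2_iff)
    have "card (S - S') = 1"
      using card_Diff_subset[OF fS' S(1)] cS c2 by simp
    then obtain x where x: "S - S' = {x}" by (auto simp: card_1_singleton_iff)
    then have Sx: "S = {x, y, y'}" using y S(1) by blast
    have ind: "a = 0 \<and> b = 0" if "a *\<^sub>R y + b *\<^sub>R y' = 0" for a b
    proof -
      have "(\<Sum>w\<in>{y, y'}. (if w = y then a else b) *\<^sub>R w) = 0"
        using that y by simp
      from independentD[OF S'(2)[unfolded y(1)] _ subset_refl this, of y]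
        independentD[OF S'(2)[unfolded y(1)] _ subset_refl this, of y'] y(2)
      show ?thesis by simp
    qed
    have "x \<notin> S'" using x by blast
    have "insert x S' = S" using Sx y(1) by simp
    then have "independent (insert x S')" using S(3) by simp
    then have "x \<notin> span S'"
      unfolding independent_insert using \<open>x \<notin> S'\<close> by simp
    moreover have "span {h, x, y, y'} = UNIV"
      using B(4) unfolding Bh Sx by blast
    ultimately show False
      using second_derived_not_plane[OF _ _ _ ind, of h x] spS[symmetric] spS'[symmetric]
      unfolding Sx y(1) by blast
  qed
  then have "card S' \<le> 1" using \<open>card S' < 3\<close> by simp
  obtain z where z: "z \<in> S" "S' \<subseteq> {z}" "\<And>a. a \<in> ?N \<Longrightarrow> br a z = 0"
  proof (cases "card S' = 0")
    case True
    then have "S' = {}" using fS' by simp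
    then have "?N' = {0}" using spS' by simp
    then have "br a b = 0" if "a \<in> ?N" "b \<in> ?N" for a b
      using br_in_derived_Suc[OF that] by simp
    moreover obtain z where "z \<in> S" using cS by fastforce
    ultimately show ?thesis using that S(2) \<open>S' = {}\<close> by blast
  next
    case False
    then obtain z where z: "S' = {z}"
      using \<open>card S' \<le> 1\<close> by (auto simp: card_1_singleton_iff le_Suc_eq)
    have "br v z \<in> span {z}" for v
      using derived_series_ideal[of z "Suc (Suc 0)" v] S'(1) spS'[symmetric] z by simp
    from ideal_line_centralized[OF this] show ?thesis
      using that z S(1) by blast
  qed
  have "card (S - {z}) = 2" using cS z(1) fS by simp
  then obtain u v where uv: "S - {z} = {u, v}" by (auto simp: card_2_iff)
  then have Suv: "S = {u, v, z}" using z(1) by blast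
  have inN: "u \<in> ?N" "v \<in> ?N" "z \<in> ?N" using Suv S(2) by auto
  have "br u v \<in> span {z}"
    using br_in_derived_Suc[OF inN(1,2)] span_mono[OF z(2)] unfolding spS' by blast
  then obtain t where t: "br u v = t *\<^sub>R z" by (auto simp: span_breakdown_eq)
  have h_coeffs: "\<exists>p q r. br h a = p *\<^sub>R u + q *\<^sub>R v + r *\<^sub>R z" if "a \<in> ?N" for a
    using derived_series_ideal[OF that, of h] unfolding spS[symmetric] Suv span3_iff .
  obtain d11 d12 d13 where d1: "br h u = d11 *\<^sub>R u + d12 *\<^sub>R v + d13 *\<^sub>R z"
    using h_coeffs[OF inN(1)] by blast
  obtain d21 d22 d23 where d2: "br h v = d21 *\<^sub>R u + d22 *\<^sub>R v + d23 *\<^sub>R z"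
    using h_coeffs[OF inN(2)] by blast
  have c: "br u z = 0" "br v z = 0" using z(3) inN by auto
  have sp: "span {h, u, v, z} = UNIV" using B(4) unfolding Bh Suv by blast
  have z0: "z \<noteq> 0" using S(3) z(1) dependent_zero by blast
  have "br h (br u v) = br (br h u) v + br u (br h v)"
    by (rule br_derivation)
  then have J: "t *\<^sub>R br h z = t *\<^sub>R (d11 + d22) *\<^sub>R z"
    using br_skew[of z v] c by (simp add: t d1 d2 br_linear br_self algebra_simps)
  show ?thesis
  proof (cases "t = 0")
    case True
    obtain d31 d32 d33 where "br h z = d31 *\<^sub>R u + d32 *\<^sub>R v + d33 *\<^sub>R z"
      using h_coeffs[OF inN(3)] by blast
    with True show ?thesis
      using that[OF sp z0 c t d1 d2] by simp
  next
    case False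
    from scaleR_left_imp_eq[OF this J]
    have "br h z = 0 *\<^sub>R u + 0 *\<^sub>R v + (d11 + d22) *\<^sub>R z" by simp
    from that[OF sp z0 c t d1 d2 this] show ?thesis by simp
  qed
qed

end

section \<open>The standard basis of so(3)\<close>

text \<open>
  The matrix of \<open>x \<mapsto> a \<times> x\<close>; the Lie algebra so(3) is \<open>\<real>\<^sup>3\<close> with the cross product.
\<close>

lift_definition cross_matrix :: "real^3 \<Rightarrow> so3" is
  "\<lambda>a. \<chi> i j. (cross3 a (axis j 1)) $ i"
  by (simp add: vec_eq_iff transpose_def forall_3 cross3_def axis_def)

lemma so3_bracket_cross_matrix:
  "so3_bracket (cross_matrix a) (cross_matrix b) = cross_matrix (cross3 a b)"
  by transfer
    (simp add: vec_eq_iff forall_3 matrix_matrix_mult_def sum_3 cross3_def axis_def algebra_simps)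

lemma linear_cross_matrix: "linear cross_matrix"
  by (rule linearI; transfer) (simp_all add: vec_eq_iff forall_3 cross3_def axis_def algebra_simps)

lemma bij_cross_matrix: "bij cross_matrix"
proof (rule o_bij)
  let ?f = "\<lambda>X. vector [Rep_so3 X $ 3 $ 2, Rep_so3 X $ 1 $ 3, Rep_so3 X $ 2 $ 1] :: real^3"
  have "?f (cross_matrix a) = a" for a
    by (simp add: cross_matrix.rep_eq vec_eq_iff forall_3 cross3_def axis_def)
  then show "?f \<circ> cross_matrix = id" by auto
  have "cross_matrix (?f X) = X" for X
  proof (transfer)
    fix X :: "real^3^3"
    assume X: "transpose X = - X"
    have e: "X $ j $ i = - X $ i $ j" for i j
      using arg_cong[OF X, of "\<lambda>A. A $ i $ j"] by (simp add: transpose_def)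
    have "X $ 1 $ 1 = 0" "X $ 2 $ 2 = 0" "X $ 3 $ 3 = 0"
      using e[of 1 1] e[of 2 2] e[of 3 3] by simp_all
    then show "(\<chi> i j. cross3 (vector [X $ 3 $ 2, X $ 1 $ 3, X $ 2 $ 1]) (axis j 1) $ i) = X"
      using e[of 1 2] e[of 3 1] e[of 2 3]
      by (simp add: vec_eq_iff forall_3 cross3_def axis_def)
  qed
  then show "cross_matrix \<circ> ?f = id" by auto
qed

lemma so3_standard_basis:
  obtains e1 e2 e3 where
    "so3_bracket e1 e2 = e3" "so3_bracket e2 e3 = e1" "so3_bracket e3 e1 = e2"
    "e1 \<noteq> e2" "e1 \<noteq> e3" "e2 \<noteq> e3"
    "independent {e1, e2, e3}" "span {e1, e2, e3} = UNIV"
proof -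
  let ?a = "\<lambda>i::3. axis i (1::real)"
  have "range ?a = {?a 1, ?a 2, ?a 3}"
    by (auto simp: UNIV_3)
  moreover have "Basis = range ?a"
    by (auto simp: Basis_vec_def)
  ultimately have b: "Basis = {?a 1, ?a 2, ?a 3}" by simp
  note inj = bij_is_inj[OF bij_cross_matrix]
  show ?thesis
  proof (rule that[of "cross_matrix (?a 1)" "cross_matrix (?a 2)" "cross_matrix (?a 3)"])
    have im: "{cross_matrix (?a 1), cross_matrix (?a 2), cross_matrix (?a 3)} = cross_matrix ` Basis"
      by (simp add: b)
    show "independent {cross_matrix (?a 1), cross_matrix (?a 2), cross_matrix (?a 3)}"
      unfolding im using independent_Basis inj
      by (intro linear_independent_injective_image[OF linear_cross_matrix]) (auto intro: inj_on_subset)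
    show "span {cross_matrix (?a 1), cross_matrix (?a 2), cross_matrix (?a 3)} = UNIV"
      unfolding im linear_span_image[OF linear_cross_matrix]
      using bij_is_surj[OF bij_cross_matrix] by simp
  qed (simp_all add: so3_bracket_cross_matrix cross_basis inj_eq[OF inj] axis_eq_axis)
qed


section \<open>The product of so(3) and a solvable Lie algebra\<close>

lemma extend_to_basis:
  fixes S :: "'a::real_vector set"
  assumes "independent S" "dim (UNIV :: 'a set) = n" "n > 0"
  obtains B where "S \<subseteq> B" "finite B" "card B = n" "span B = UNIV"
proof -
  obtain B where B: "S \<subseteq> B" "B \<subseteq> UNIV" "independent B" "UNIV \<subseteq> span B"
    by (rule maximal_independent_subset_extend[OF subset_UNIV assms(1)])
  have "card B = n"
    using basis_card_eq_dim[OF B(2,4,3)] assms(2) by simp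
  moreover from this have "finite B"
    using assms(3) by (metis card.infinite less_irrefl)
  ultimately show ?thesis using that B(1,4) by blast
qed

lemma span_product_frame:
  assumes "span {x, y, z} = UNIV" "span {h, u, v, w} = UNIV"
  shows "span (set [(x, 0), (y, 0), (z, 0), (0, h), (0, u), (0, v), (0, w)]) = UNIV"
proof -
  have "set [(x, 0), (y, 0), (z, 0), (0, h), (0, u), (0, v), (0, w)]
      = (\<lambda>a. (a, 0)) ` {x, y, z} \<union> (\<lambda>b. (0, b)) ` {h, u, v, w}"
    by auto
  then show ?thesis using span_prod_UNIV[OF assms] by simp
qed

text \<open>
  Any basis of the first factor that contains \<open>x\<close> gives a frame for \<open>g2_b_eq_0_degenerate\<close>.
\<close>

lemma no_degenerate_vertical_contraction:
  fixes x :: "'a::real_vector" and \<phi> :: "('a \<times> 'b::real_vector) list \<Rightarrow> real"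
  assumes g2: "g2_structure \<phi>" and "x \<noteq> 0"
    and dims: "dim (UNIV :: 'a set) = 3" "dim (UNIV :: 'b set) = 4"
    and 0: "\<And>p q. \<phi> [(x, 0), (0, p), (0, q)] = 0"
  shows False
proof -
  have \<phi>: "\<phi> \<in> forms 3" using g2 by (simp add: g2_structure_def)
  have "independent {x}" using \<open>x \<noteq> 0\<close> by simp
  from extend_to_basis[OF this dims(1)] obtain B where
    B: "{x} \<subseteq> B" "finite B" "card B = 3" "span B = UNIV" by auto
  have "card (B - {x}) = 2" using B by simp
  then obtain y z where "B - {x} = {y, z}" by (auto simp: card_2_iff)
  then have B': "B = {x, y, z}" using B(1) by blast
  from extend_to_basis[OF independent_empty dims(2)] obtain C :: "'b set" where
    C: "finite C" "card C = 4" "span C = UNIV" by auto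
  obtain cs where cs: "set cs = C" "length cs = 4"
    using finite_distinct_list[OF C(1)] C(2) distinct_card by metis
  then obtain h u v w where "cs = [h, u, v, w]"
    by (auto simp: length_Suc_conv eval_nat_numeral)
  with cs C(3) have "span {h, u, v, w} = UNIV" by auto
  from span_product_frame[OF B(4)[unfolded B'] this]
  have "(\<Sum>a\<in>{(x, 0)}. g2_b \<phi> a a [(x, 0), (y, 0), (z, 0), (0, h), (0, u), (0, v), (0, w)]) \<noteq> 0"
    by (intro g2_structure_sum_nonzero[OF g2]) (use \<open>x \<noteq> 0\<close> in \<open>auto simp: zero_prod_def\<close>)
  moreover have "g2_b \<phi> (x, 0) (x, 0) [(x, 0), (y, 0), (z, 0), (0, h), (0, u), (0, v), (0, w)] = 0"
    by (rule g2_b_eq_0_degenerate[OF \<phi>]) (auto simp: 0)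
  ultimately show False by simp
qed

theorem proposition4p7:
  fixes br :: "'r::real_vector \<Rightarrow> 'r \<Rightarrow> 'r"
  assumes "lie_algebra br"
    and "dim (UNIV :: 'r set) = 4"
    and "lie_solvable br"
    and "lie_center br = {0}"
  shows "\<not> (\<exists>\<phi>. closed_g2_structure (lie_prod so3_bracket br) \<phi>)"
proof
  assume "\<exists>\<phi>. closed_g2_structure (lie_prod so3_bracket br) \<phi>"
  then obtain \<phi> where g2: "g2_structure \<phi>"
    and closed: "ce_d (lie_prod so3_bracket br) \<phi> = (\<lambda>_. 0)"
    by (auto simp: closed_g2_structure_def)
  have \<phi>: "\<phi> \<in> forms 3" using g2 by (simp add: g2_structure_def)
  note lin = three_form_linear[OF \<phi>]
  interpret lie_algebra br by fact
  obtain e1 e2 e3 where e: "so3_bracket e1 e2 = e3" "so3_bracket e2 e3 = e1" "so3_bracket e3 e1 = e2"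
    and e_neq: "e1 \<noteq> e2" "e1 \<noteq> e3" "e2 \<noteq> e3"
    and e_ind: "independent {e1, e2, e3}" and e_span: "span {e1, e2, e3} = UNIV"
    by (rule so3_standard_basis)
  have dim_so3: "dim (UNIV :: so3 set) = 3"
    using basis_card_eq_dim[OF subset_UNIV _ e_ind] e_span e_neq by simp
  define A where "A x y p = \<phi> [(x, 0), (y, 0), (0, p)]" for x y :: so3 and p :: 'r
  have "linear (A x y)" for x y
  proof -
    have "linear (\<lambda>p::'r. (0::so3, p))" by (simp add: linear_iff)
    from linear_compose[OF this lin(3)] show ?thesis
      by (simp add: A_def[abs_def] o_def)
  qed
  note A_linear = linear_add[OF this] linear_scale[OF this] linear_0[OF this]
  have W: "\<phi> [(z, 0), (0, p), (0, q)] = - A x y (br p q)" if "so3_bracket x y = z" for x y z p q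
    using closed_on_product_mixed[OF lie_algebra_so3 assms(1) \<phi> closed, of x y p q] that
    by (simp add: A_def)

  \<comment> \<open>Otherwise some \<open>x = c\<^sub>1 e\<^sub>1 + c\<^sub>2 e\<^sub>2 + c\<^sub>3 e\<^sub>3\<close> has \<open>c\<^sub>1 A\<^sub>1 + c\<^sub>2 A\<^sub>2 + c\<^sub>3 A\<^sub>3 = 0\<close> on the commutators:
    two linear conditions on \<open>c\<close>, at \<open>p\<close> and at \<open>q\<close>.\<close>
  have "\<not> derived_series br (Suc 0) \<subseteq> span {p, q}" for p q
  proof
    assume sub: "derived_series br (Suc 0) \<subseteq> span {p, q}"
    let ?a = "\<lambda>w. vector [A e2 e3 w, A e3 e1 w, A e1 e2 w] :: real^3"
    have "dim {?a p, ?a q} \<le> card {?a p, ?a q}"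
      by (rule dim_le_card) (auto intro: span_base)
    also have "\<dots> \<le> 2" by (simp add: card_insert_if)
    finally have "dim {?a p, ?a q} < DIM(real^3)" by simp
    from orthogonal_to_subspace_exists[OF this] obtain c :: "real^3" where
      c: "c \<noteq> 0" "\<And>w. w \<in> span {?a p, ?a q} \<Longrightarrow> orthogonal c w" by blast
    then have "orthogonal c (?a p)" "orthogonal c (?a q)"
      by (auto intro: span_base)
    then have orth: "c$1 * A e2 e3 w + c$2 * A e3 e1 w + c$3 * A e1 e2 w = 0" if "w \<in> {p, q}" for w
      using that by (auto simp: orthogonal_def inner_vec_def sum_3)
    let ?x = "c$1 *\<^sub>R e1 + c$2 *\<^sub>R e2 + c$3 *\<^sub>R e3"
    have "?x \<noteq> 0"
    proof
      assume "?x = 0"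
      let ?k = "\<lambda>w. if w = e1 then c$1 else if w = e2 then c$2 else c$3"
      have "(\<Sum>w\<in>{e1, e2, e3}. ?k w *\<^sub>R w) = 0"
        using \<open>?x = 0\<close> e_neq by (simp add: add.assoc)
      from independentD[OF e_ind _ subset_refl this]
      have "?k w = 0" if "w \<in> {e1, e2, e3}" for w using that by blast
      from this[of e1] this[of e2] this[of e3] e_neq
      have "c = 0" by (simp add: vec_eq_iff forall_3)
      with c(1) show False ..
    qed
    moreover have "\<phi> [(?x, 0), (0, v), (0, w)] = 0" for v w
    proof -
      have "br v w \<in> span {p, q}"
        using sub br_in_derived_Suc[of v 0 w] by auto
      then obtain r s where rs: "br v w = r *\<^sub>R p + s *\<^sub>R q"
        unfolding span2_iff by blast
      have "(?x, 0 :: 'r) = c$1 *\<^sub>R (e1, 0) + c$2 *\<^sub>R (e2, 0) + c$3 *\<^sub>R (e3, 0)"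
        by simp
      then have "\<phi> [(?x, 0), (0, v), (0, w)] =
        - (c$1 * A e2 e3 (br v w) + c$2 * A e3 e1 (br v w) + c$3 * A e1 e2 (br v w))"
        by (simp only: linear_add[OF lin(1)] linear_scale[OF lin(1)] W[OF e(1)] W[OF e(2)] W[OF e(3)])
           simp
      also have "\<dots> = - (r * (c$1 * A e2 e3 p + c$2 * A e3 e1 p + c$3 * A e1 e2 p)
          + s * (c$1 * A e2 e3 q + c$2 * A e3 e1 q + c$3 * A e1 e2 q))"
        by (simp add: rs A_linear algebra_simps)
      finally show ?thesis by (simp add: orth)
    qed
    ultimately show False
      by (rule no_degenerate_vertical_contraction[OF g2 _ dim_so3 assms(2)])
  qed
  then obtain h u v z d11 d12 d13 d21 d22 d23 d31 d32 d33 t where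
    r_span: "span {h, u, v, z} = UNIV" and "z \<noteq> 0"
    and uvz: "br u z = 0" "br v z = 0" "br u v = t *\<^sub>R z"
    and hu: "br h u = d11 *\<^sub>R u + d12 *\<^sub>R v + d13 *\<^sub>R z"
    and hv: "br h v = d21 *\<^sub>R u + d22 *\<^sub>R v + d23 *\<^sub>R z"
    and hz: "br h z = d31 *\<^sub>R u + d32 *\<^sub>R v + d33 *\<^sub>R z"
    and t: "t * d31 = 0" "t * d32 = 0" "t * d33 = t * (d11 + d22)"
    by (rule derived_three_dim_structure[OF assms(2,3)])
  let ?F = "[(e1, 0), (e2, 0), (e3, 0), (0, h), (0, u), (0, v), (0, z)] :: (so3 \<times> 'r) list"
  have nonzero: "(\<Sum>a\<in>V. g2_b \<phi> a a ?F) \<noteq> 0" if "finite V" "V \<noteq> {}" "0 \<notin> V" for V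
    using that by (intro g2_structure_sum_nonzero[OF g2 span_product_frame[OF e_span r_span]]) simp_all

  let ?\<psi> = "\<lambda>a b c. \<phi> [(0, a), (0, b), (0, c)]"
  have \<psi>_linear: "linear (\<lambda>a. ?\<psi> a b c)" for b c
  proof -
    have "linear (\<lambda>p::'r. (0::so3, p))" by (simp add: linear_iff)
    from linear_compose[OF this lin(1)] show ?thesis by (simp add: o_def)
  qed
  have "(d11 + d22 + d33) * ?\<psi> u v z = 0"
    using closed_on_product_vertical[OF lie_algebra_so3 assms(1) \<phi> closed, of h u v z]
      three_form_swap(1)[OF \<phi>, of "(0, v)" "(0, u)" "(0, z)"]
      three_form_swap(2)[OF \<phi>, of "(0, z)" "(0, u)" "(0, v)"]
      three_form_swap(1)[OF \<phi>, of "(0, z)" "(0, v)" "(0, u)"]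
      three_form_swap(2)[OF \<phi>, of "(0, v)" "(0, z)" "(0, u)"]
    by (simp add: uvz hu hv hz linear_add[OF \<psi>_linear] linear_scale[OF \<psi>_linear]
        linear_0[OF \<psi>_linear] three_form_swap(3-5)[OF \<phi>] algebra_simps)
  then consider "?\<psi> u v z = 0" | "d11 + d22 + d33 = 0" by auto
  then show False
  proof cases
    case 1
    have "g2_b \<phi> (0, z) (0, z) ?F = 0"
      by (rule g2_b_eq_0_fibre[OF \<phi>])
         (use 1 W[OF e(1)] W[OF e(2)] W[OF e(3)] in \<open>auto simp: uvz A_linear\<close>)
    with nonzero[of "{(0, z)}"] \<open>z \<noteq> 0\<close> show False
      by (simp add: zero_prod_def)
  next
    case 2
    have "g2_b \<phi> (e1, 0) (e1, 0) ?F + g2_b \<phi> (e2, 0) (e2, 0) ?F + g2_b \<phi> (e3, 0) (e3, 0) ?F = 0"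
      by (rule g2_b_trace_eq_0[OF \<phi> _ 2 t])
         (use e in \<open>auto simp: W uvz hu hv hz A_linear A_def[symmetric]\<close>)
    moreover have "e1 \<noteq> 0" "e2 \<noteq> 0" "e3 \<noteq> 0"
      using e_ind dependent_zero[of "{e1, e2, e3}"] by auto
    ultimately show False
      using nonzero[of "{(e1, 0), (e2, 0), (e3, 0)}"] e_neq by (simp add: zero_prod_def add.assoc)
  qed
qed

end
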